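(* Consider the scalar event-triggered control system described in the context, with $A>0$, $B\ne0$, delay bound $\gamma$, triggering function $v(t)=v_0e^{-\sigma t}$ ($v_0,\sigma>0$), and design parameter $0<\rho_0<1$, and assume $|z(0)|<v_0$. Then the condition $$R_s\ \ge\ \frac{A+\sigma}{-\ln(\rho_0e^{-\sigma\gamma})}\ \max\left\{0,\ 1+\log\frac{b\gamma(A+\sigma)}{\ln\left(1+\rho_0e^{-(\sigma+A)\gamma}\right)}\right\},\qquad b>1,$$ on the information transmission rate is also a sufficient condition for asymptotic stabilizability of the plant.
   Context: $\log$ is the logarithm to base $2$, $\ln$ the natural logarithm, $\mathbb{N}$ the positive integers, $f(t^+)$ the right limit of $f$ at $t$. Plant and channel. $\dot x(t)=Ax(t)+Bu(t)$, $x(t),u(t)\in\mathbb{R}$, $A>0$, $B\ne 0$ real, $|x(0)|<L$ with $L$ known to sensor and controller. The sensor measures $x$ exactly. At times $t_s^k$ ($k\in\mathbb{N}$) the sensor transmits a packet of $g(t_s^k)$ bits, received by the controller without error at time $t_c^k$; the communication delay $\Delta_k=t_c^k-t_s^k$ is unknown, arbitrary, and satisfies $0\le\Delta_k\le\gamma$, with $\gamma$ known to both. Triggering intervals: $\Delta'_k=t_s^{k+1}-t_s^k$. Estimator and triggering. Between receptions the controller's estimate obeys $\dot{\hat x}=A\hat x+Bu$, and $u(t)$ is computed from $\hat x(t)$; the sensor can also compute $\hat x$. The state estimation error is $z=x-\hat x$. With $v(t)=v_0e^{-\sigma t}$, known to both, a transmission occurs whenever $|z(t)|=v(t)$. On reception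 the estimate jumps: $\hat x(t_c^+)=\bar z(t_c)+\hat x(t_c)$, where $\bar z(t_c)$ is an estimate of $z(t_c)$ constructed by the controller from the knowledge that $|z(t_s)|=v(t_s)$, the delay bound, the reception time $t_c$, and the decoded packet. The quantization policy (choice of packets and decoding rule) is required to guarantee $|z(t_c^{k+})|\le\rho_0e^{-\sigma\gamma}v(t_s^k)$ for all $t_c^k\in[t_s^k,t_s^k+\gamma]$ and all $k$. Information transmission rate: $R_s=\limsup_{N\to\infty}\dfrac{\sum_{k=1}^N g(t_s^k)}{\sum_{k=1}^N\Delta'_k}$. Sufficiency of a rate condition for asymptotic stabilizability means: for any such rate there are a quantization policy (choice of packets and decoding rule) guaranteeing $|z(t_c^{k+})|\le\rho_0e^{-\sigma\gamma}v(t_s^k)$ for all $t_c^k\in[t_s^k,t_s^k+\gamma]$ and all $k\in\mathbb{N}$, and a control law, which here is linear in the estimate, $u(t)=-K\hat x(t)$, such that the closed-loop state is stable and $\lim_{t\to\infty}x(t)=0$. *)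

theory Defs
  imports "HOL-Analysis.Analysis"
begin

text \<open>The triggering function \<open>v\<close>.\<close>

definition trig :: "real \<Rightarrow> real \<Rightarrow> real \<Rightarrow> real" where
  "trig v0 \<sigma> t = v0 * exp (- \<sigma> * t)"

text \<open>
  A quantization policy consists of an encoder and a decoder. A packet is a bit string. The
  encoder is given the transmission times up to and including the current one and the plant
  state and controller estimate on the time interval elapsed so far (both are \<open>undefined\<close> at
  later times). It does not see the delay of the packet it is about to send.
  The decoder is given the reception time and the packet, and returns the estimate of the state
  estimation error at the reception time.
\<close>

type_synonym encoder = "real list \<Rightarrow> (real \<Rightarrow> real) \<Rightarrow> (real \<Rightarrow> real) \<Rightarrow> bool list"
type_synonym decoder = "real \<Rightarrow> bool list \<Rightarrow> real"

text \<open>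
  One run of the closed loop on \<open>[0, \<infinity>)\<close>. There may be finitely or infinitely many transmissions;
  they are numbered from 0, and only the indices below \<open>num_trans\<close> are meaningful in \<open>send_time\<close>,
  \<open>recv_time\<close> and \<open>packet\<close>.
\<close>

record run =
  plant_state :: "real \<Rightarrow> real"
  estimate :: "real \<Rightarrow> real"
  num_trans :: enat
  send_time :: "nat \<Rightarrow> real"
  recv_time :: "nat \<Rightarrow> real"
  packet :: "nat \<Rightarrow> bool list"

definition est_error :: "run \<Rightarrow> real \<Rightarrow> real" where
  "est_error r t = plant_state r t - estimate r t"

definition trans_indices :: "run \<Rightarrow> nat set" where
  "trans_indices r = {k. enat k < num_trans r}"

definition reception_times :: "run \<Rightarrow> real set" where
  "reception_times r = recv_time r ` trans_indices r"

definition right_limit :: "(real \<Rightarrow> real) \<Rightarrow> real \<Rightarrow> real" where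
  "right_limit f t = Lim (at_right t) f"

text \<open>
  The estimate is left-continuous: its value at a reception time is the one before the jump, and
  the right limit is the one after the jump. The control law is \<open>u t = - K * estimate t\<close>.
\<close>

definition closed_loop_run ::
  "real \<Rightarrow> real \<Rightarrow> real \<Rightarrow> real \<Rightarrow> real \<Rightarrow> real \<Rightarrow> encoder \<Rightarrow> decoder \<Rightarrow> run \<Rightarrow> bool" where
  "closed_loop_run A B K \<gamma> v0 \<sigma> enc dec r \<longleftrightarrow>
    (let x = plant_state r; xh = estimate r; u = (\<lambda>t. - K * xh t);
         ts = send_time r; tc = recv_time r in
      continuous_on {0..} x \<and>
      (\<forall>t>0. t \<notin> reception_times r \<longrightarrow>
         (x has_real_derivative A * x t + B * u t) (at t)) \<and>
      (\<forall>t>0. t \<notin> reception_times r \<longrightarrow>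
         (xh has_real_derivative A * xh t + B * u t) (at t)) \<and>
      (\<forall>t>0. (xh \<longlongrightarrow> xh t) (at_left t)) \<and>
      (\<forall>t\<ge>0. t \<notin> reception_times r \<longrightarrow> (xh \<longlongrightarrow> xh t) (at_right t)) \<and>
      (\<forall>k\<in>trans_indices r.
         (xh \<longlongrightarrow> dec (tc k) (packet r k) + xh (tc k)) (at_right (tc k))) \<and>
      strict_mono_on (trans_indices r) ts \<and>
      ts ` trans_indices r = {t. 0 \<le> t \<and> \<bar>est_error r t\<bar> = trig v0 \<sigma> t} \<and>
      (\<forall>k\<in>trans_indices r. ts k \<le> tc k \<and> tc k \<le> ts k + \<gamma>) \<and>
      (\<forall>k\<in>trans_indices r.
         packet r k =
           enc (map ts [0..<Suc k]) (restrict x {0..ts k}) (restrict xh {0..ts k})))"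

definition admissible_run ::
  "real \<Rightarrow> real \<Rightarrow> real \<Rightarrow> real \<Rightarrow> real \<Rightarrow> real \<Rightarrow> real \<Rightarrow> encoder \<Rightarrow> decoder \<Rightarrow> run \<Rightarrow> bool" where
  "admissible_run A B K L \<gamma> v0 \<sigma> enc dec r \<longleftrightarrow>
    closed_loop_run A B K \<gamma> v0 \<sigma> enc dec r \<and>
    \<bar>plant_state r 0\<bar> < L \<and> \<bar>est_error r 0\<bar> < v0"

text \<open>
  The information transmission rate, meaningful for runs with infinitely many transmissions.
\<close>

definition info_rate :: "run \<Rightarrow> ereal" where
  "info_rate r = limsup (\<lambda>N. ereal
     ((\<Sum>k<N. real (length (packet r k))) / (\<Sum>k<N. send_time r (Suc k) - send_time r k)))"

text \<open>
  For \<open>\<gamma> = 0\<close> the argument of the logarithm vanishes; the maximum is then 0 by the convention that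
  the logarithm of 0 is \<open>-\<infinity>\<close>, whereas \<open>log 2 0 = 0\<close> here, hence the case distinction.
\<close>

definition sufficient_rate :: "real \<Rightarrow> real \<Rightarrow> real \<Rightarrow> real \<Rightarrow> real \<Rightarrow> real" where
  "sufficient_rate A \<gamma> \<sigma> \<rho>0 b =
    (A + \<sigma>) / (- ln (\<rho>0 * exp (- \<sigma> * \<gamma>))) *
    (if \<gamma> = 0 then 0
     else max 0 (1 + log 2 (b * \<gamma> * (A + \<sigma>) / ln (1 + \<rho>0 * exp (- (\<sigma> + A) * \<gamma>)))))"

end

theory Submission
  imports Defs
begin

text \<open>
  With \<open>u = - K * xh\<close> and \<open>B * K = A + \<sigma> + 1\<close> the state obeys
  \<open>x' = - (\<sigma> + 1) * x + (A + \<sigma> + 1) * z\<close>, so it decays as soon as the error \<open>z\<close> is bounded by a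
  multiple of \<open>v\<close>. Between the receptions \<open>z\<close> grows like \<open>exp (A * t)\<close>; hence \<open>z\<close> at a reception
  time is determined by its sign at the transmission and by the transmission time \<open>t\<close>, and it
  suffices to communicate \<open>t\<close> up to the precision
  \<open>D = ln (1 + \<rho>0 * exp (- (\<sigma> + A) * \<gamma>)) / (A + \<sigma>)\<close>.

  The decoder errs deliberately to one side, so that after a reception \<open>z\<close> lies between two positive
  multiples of \<open>v\<close>. Only the first packet then needs a sign, and the gaps between transmissions
  are bounded from both sides. With \<open>G\<close> the maximum in the rate condition, the lower bound on a gap
  gives an average of \<open>G\<close> bits per packet. As \<open>G\<close> need not be an integer, the labels of a
  cyclic partition of the time axis into cells of width \<open>D / b\<close> are encoded by all bit strings of
  length at most \<open>m = \<lfloor>G\<rfloor>\<close>. There are \<open>2 ^ Suc m - 1\<close> of them, which is enough: the \<open>2 ^ m\<close> strings of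
  length \<open>m\<close> are not, because a window of length \<open>\<gamma>\<close> may meet one cell more than its length suggests.
  Whenever the bits sent so far fall short of the rate \<open>R\<close> by more than \<open>m\<close>, a packet is padded to a
  greater length to make up for it, so the rate is exactly \<open>R\<close>.
\<close>

subsection \<open>Linear differential equations\<close>

text \<open>\<open>f s * exp (- \<alpha> * s)\<close> is constant on the open interval. The initial
  value enters as a right limit because the error jumps at receptions, where its value is the one
  before the jump.\<close>

lemma exp_ode_solution:
  fixes f :: "real \<Rightarrow> real"
  assumes "a < t"
    and der: "\<And>s. a < s \<Longrightarrow> s < t \<Longrightarrow> (f has_real_derivative \<alpha> * f s) (at s)"
    and right: "(f \<longlongrightarrow> l) (at_right a)"
    and left: "(f \<longlongrightarrow> f t) (at_left t)"
  shows "f t = l * exp (\<alpha> * (t - a))"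
proof -
  have "\<exists>c. \<forall>s\<in>{a<..<t}. f s * exp (- \<alpha> * s) = c"
  proof (rule has_field_derivative_zero_constant)
    fix s assume "s \<in> {a<..<t}"
    then have "((\<lambda>s. f s * exp (- \<alpha> * s)) has_real_derivative 0) (at s)"
      by (auto intro!: derivative_eq_intros der)
    then show "((\<lambda>s. f s * exp (- \<alpha> * s)) has_real_derivative 0) (at s within {a<..<t})"
      by (rule has_field_derivative_at_within)
  qed simp
  then obtain c where "\<And>s. s \<in> {a<..<t} \<Longrightarrow> f s * exp (- \<alpha> * s) = c"
    by blast
  then have c: "f s = c * exp (\<alpha> * s)" if "a < s" "s < t" for s
    using that by (fastforce simp: exp_minus field_simps)
  have "\<forall>\<^sub>F s in at_right a. f s = c * exp (\<alpha> * s)"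
    unfolding eventually_at_right[OF \<open>a < t\<close>] using c \<open>a < t\<close> by blast
  then have "((\<lambda>s. c * exp (\<alpha> * s)) \<longlongrightarrow> l) (at_right a)"
    using right tendsto_cong by fast
  moreover have "((\<lambda>s. c * exp (\<alpha> * s)) \<longlongrightarrow> c * exp (\<alpha> * a)) (at_right a)"
    by (intro tendsto_intros)
  ultimately have l: "l = c * exp (\<alpha> * a)"
    using tendsto_unique by force
  have "\<forall>\<^sub>F s in at_left t. f s = c * exp (\<alpha> * s)"
    unfolding eventually_at_left[OF \<open>a < t\<close>] using c \<open>a < t\<close> by blast
  then have "((\<lambda>s. c * exp (\<alpha> * s)) \<longlongrightarrow> f t) (at_left t)"
    using left tendsto_cong by fast
  moreover have "((\<lambda>s. c * exp (\<alpha> * s)) \<longlongrightarrow> c * exp (\<alpha> * t)) (at_left t)"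
    by (intro tendsto_intros)
  ultimately have "f t = c * exp (\<alpha> * t)"
    using tendsto_unique by force
  then show ?thesis
    by (simp add: l mult.assoc flip: exp_add) (simp add: algebra_simps)
qed

text \<open>Integrate \<open>exp (\<beta> * s) * x s\<close>, whose derivative
  \<open>exp (\<beta> * s) * (c * z s)\<close> is dominated by
  \<open>c * E * exp ((\<beta> - \<mu>) * s)\<close>. The set \<open>S\<close> is meant for
  reception times, at which \<open>x\<close> is continuous but may have a kink.\<close>

lemma perturbed_linear_ode_bound:
  fixes x z :: "real \<Rightarrow> real"
  assumes "0 \<le> t" "\<mu> < \<beta>" "0 \<le> c"
    and cont: "continuous_on {0..t} x" and "finite S"
    and der: "\<And>s. 0 < s \<Longrightarrow> s < t \<Longrightarrow> s \<notin> S \<Longrightarrow>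
      (x has_real_derivative - \<beta> * x s + c * z s) (at s)"
    and z: "\<And>s. 0 \<le> s \<Longrightarrow> s \<le> t \<Longrightarrow> \<bar>z s\<bar> \<le> E * exp (- \<mu> * s)"
  shows "\<bar>x t\<bar> \<le> \<bar>x 0\<bar> * exp (- \<beta> * t) + c * E / (\<beta> - \<mu>) * exp (- \<mu> * t)"
proof -
  define g where "g s = exp (\<beta> * s) * x s" for s
  define g' where "g' s = exp (\<beta> * s) * (c * z s)" for s
  define h where "h s = c * E / (\<beta> - \<mu>) * exp ((\<beta> - \<mu>) * s)" for s
  define h' where "h' s = c * E * exp ((\<beta> - \<mu>) * s)" for s
  have g_int: "(g' has_integral g t - g 0) {0..t}"
  proof (rule fundamental_theorem_of_calculus_interior_strong[OF \<open>finite S\<close> \<open>0 \<le> t\<close>])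
    show "continuous_on {0..t} g"
      unfolding g_def by (intro continuous_intros cont)
    show "(g has_vector_derivative g' s) (at s)" if "s \<in> {0<..<t} - S" for s
      unfolding g_def g'_def has_real_derivative_iff_has_vector_derivative[symmetric]
      using that by (auto intro!: derivative_eq_intros der simp: algebra_simps)
  qed
  have h_int: "(h' has_integral h t - h 0) {0..t}"
  proof (rule fundamental_theorem_of_calculus[OF \<open>0 \<le> t\<close>])
    show "(h has_vector_derivative h' s) (at s within {0..t})" for s
      unfolding h_def h'_def has_real_derivative_iff_has_vector_derivative[symmetric]
      using \<open>\<mu> < \<beta>\<close> by (auto intro!: derivative_eq_intros)
  qed
  have le: "\<bar>g' s\<bar> \<le> h' s" if "s \<in> {0..t}" for s
  proof -
    have "\<bar>g' s\<bar> = exp (\<beta> * s) * (c * \<bar>z s\<bar>)"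
      using \<open>0 \<le> c\<close> by (simp add: g'_def abs_mult)
    also have "\<dots> \<le> exp (\<beta> * s) * (c * (E * exp (- \<mu> * s)))"
      using z[of s] that \<open>0 \<le> c\<close> by (intro mult_left_mono) auto
    also have "\<dots> = h' s"
      by (simp add: h'_def left_diff_distrib exp_diff exp_minus field_simps)
    finally show ?thesis .
  qed
  have "g t - g 0 \<le> h t - h 0"
    using le by (intro has_integral_le[OF g_int h_int]) (auto simp: abs_le_iff)
  moreover have "- (g t - g 0) \<le> h t - h 0"
    using le by (intro has_integral_le[OF has_integral_neg[OF g_int] h_int]) (auto simp: abs_le_iff)
  moreover have "0 \<le> E"
    using z[of 0] \<open>0 \<le> t\<close> by simp
  then have "0 \<le> h 0"
    using \<open>\<mu> < \<beta>\<close> \<open>0 \<le> c\<close> by (simp add: h_def)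
  ultimately have "\<bar>g t\<bar> \<le> \<bar>x 0\<bar> + h t"
    by (simp add: g_def)
  have "\<bar>x t\<bar> = \<bar>g t\<bar> * exp (- \<beta> * t)"
    by (simp add: g_def abs_mult exp_minus field_simps)
  also have "\<dots> \<le> (\<bar>x 0\<bar> + h t) * exp (- \<beta> * t)"
    using \<open>\<bar>g t\<bar> \<le> _\<close> by (intro mult_right_mono) auto
  also have "\<dots> = \<bar>x 0\<bar> * exp (- \<beta> * t) + c * E / (\<beta> - \<mu>) * exp (- \<mu> * t)"
    by (simp add: h_def distrib_right mult.assoc flip: exp_add) (simp add: algebra_simps)
  finally show ?thesis .
qed

lemma tendsto_exp_neg_at_top:
  fixes c :: real
  assumes "0 < c"
  shows "((\<lambda>t. exp (- c * t)) \<longlongrightarrow> 0) at_top"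
  using assms
  by (intro filterlim_compose[OF exp_at_bot] filterlim_tendsto_neg_mult_at_bot[OF tendsto_const])
    (auto simp: filterlim_ident)

subsection \<open>Labels and codes\<close>

text \<open>A time is labelled by the index of its cell of width \<open>w\<close>, modulo
  \<open>2 ^ Suc m - 1\<close>. Times at most \<open>\<gamma>\<close> apart have indices that differ
  by at most \<open>2 ^ m\<close>, which is below the modulus if \<open>1 \<le> m\<close>; so equal
  labels force equal cells. For \<open>m = 0\<close> the modulus would be 1, but then
  \<open>\<gamma> < w\<close> and a constant label will do.\<close>

lemma cyclic_labelling:
  fixes \<gamma> w :: real
  assumes "0 \<le> \<gamma>" "0 < w" "\<gamma> < 2 ^ m * w"
  shows "\<exists>lab :: real \<Rightarrow> nat. (\<forall>t. lab t < 2 ^ Suc m - 1) \<and>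
    (\<forall>t t'. lab t = lab t' \<longrightarrow> \<bar>t - t'\<bar> \<le> \<gamma> \<longrightarrow> \<bar>t - t'\<bar> \<le> w)"
proof (cases "m = 0")
  case True
  then show ?thesis
    using assms by (intro exI[of _ "\<lambda>_. 0"]) auto
next
  case False
  define M :: int where "M = 2 ^ Suc m - 1"
  have "2 ^ 1 \<le> (2 :: int) ^ m"
    using False by (intro power_increasing) auto
  then have M: "2 ^ m + 1 \<le> M"
    by (simp add: M_def)
  define lab where "lab t = nat (\<lfloor>t / w\<rfloor> mod M)" for t
  have "0 < M"
    using M by (smt (verit) zero_less_power)
  have "lab t < 2 ^ Suc m - 1" for t
  proof -
    have "int (lab t) < M"
      using \<open>0 < M\<close> by (simp add: lab_def)
    also have "M = int (2 ^ Suc m - 1)"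
      by (simp add: M_def of_nat_diff)
    finally show ?thesis
      by linarith
  qed
  moreover have "\<bar>t - t'\<bar> \<le> w" if lab: "lab t = lab t'" and close: "\<bar>t - t'\<bar> \<le> \<gamma>" for t t'
  proof -
    have "\<lfloor>t / w\<rfloor> mod M = \<lfloor>t' / w\<rfloor> mod M"
      using lab \<open>0 < M\<close> by (simp add: lab_def eq_nat_nat_iff)
    then obtain q where q: "\<lfloor>t / w\<rfloor> - \<lfloor>t' / w\<rfloor> = M * q"
      by (auto simp: mod_eq_dvd_iff dvd_def)
    have "\<bar>t / w - t' / w\<bar> = \<bar>t - t'\<bar> / w"
      using \<open>0 < w\<close> by (simp add: diff_divide_distrib[symmetric])
    also have "\<dots> \<le> \<gamma> / w"
      using close \<open>0 < w\<close> by (simp add: divide_right_mono)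
    also have "\<dots> < 2 ^ m"
      using assms by (simp add: pos_divide_less_eq)
    finally have "\<bar>t / w - t' / w\<bar> < real_of_int (2 ^ m)"
      by simp
    then have "\<bar>\<lfloor>t / w\<rfloor> - \<lfloor>t' / w\<rfloor>\<bar> < 2 ^ m + 1"
      by linarith
    then have "\<bar>M * q\<bar> < M"
      using q M by linarith
    then have "q = 0"
      using \<open>0 < M\<close> by (simp add: abs_mult)
    then have "\<bar>t / w - t' / w\<bar> \<le> 1"
      using q by simp linarith
    then have "\<bar>t - t'\<bar> / w \<le> 1"
      using \<open>0 < w\<close> by (simp add: diff_divide_distrib[symmetric])
    then show ?thesis
      using \<open>0 < w\<close> by simp
  qed
  ultimately show ?thesis
    by blast
qed

text \<open>Packets arrive one by one, so the decoder sees their lengths and can tell apart strings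
  of all lengths up to \<open>m\<close>. The codewords of fixed length serve packets with trailing
  bits, where the end of the codeword must be known.\<close>

lemma ex_bit_codes:
  shows "\<exists>c :: nat \<Rightarrow> bool list. inj_on c {..<2 ^ Suc m - 1} \<and> (\<forall>i<2 ^ Suc m - 1. length (c i) \<le> m)"
    and "\<exists>c :: nat \<Rightarrow> bool list. inj_on c {..<2 ^ m} \<and> (\<forall>i<2 ^ m. length (c i) = m)"
proof -
  let ?S = "{xs :: bool list. length xs \<le> m}"
  have "finite ?S"
    using finite_lists_length_le[of "UNIV :: bool set" m] by simp
  moreover have "card ?S = 2 ^ Suc m - 1"
    using card_lists_length_le[of "UNIV :: bool set" m] sum_power2[of "Suc m"]
    unfolding atLeast0LessThan lessThan_Suc_atMost card_UNIV_bool by simp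
  ultimately obtain c :: "nat \<Rightarrow> bool list" where "bij_betw c {0..<2 ^ Suc m - 1} ?S"
    using ex_bij_betw_nat_finite by metis
  then show "\<exists>c :: nat \<Rightarrow> bool list. inj_on c {..<2 ^ Suc m - 1} \<and>
      (\<forall>i<2 ^ Suc m - 1. length (c i) \<le> m)"
    unfolding atLeast0LessThan by (intro exI[of _ c]) (auto simp: bij_betw_def)
  let ?T = "{xs :: bool list. length xs = m}"
  have "finite ?T"
    using finite_lists_length_eq[of "UNIV :: bool set" m] by simp
  moreover have "card ?T = 2 ^ m"
    using card_lists_length_eq[of "UNIV :: bool set" m] by simp
  ultimately obtain c :: "nat \<Rightarrow> bool list" where "bij_betw c {0..<2 ^ m} ?T"
    using ex_bij_betw_nat_finite by metis
  then show "\<exists>c :: nat \<Rightarrow> bool list. inj_on c {..<2 ^ m} \<and> (\<forall>i<2 ^ m. length (c i) = m)"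
    unfolding atLeast0LessThan by (intro exI[of _ c]) (auto simp: bij_betw_def)
qed

subsection \<open>The quantization policy\<close>

text \<open>\<open>w\<close> is the uncertainty left about a transmission time, and
  \<open>\<epsilon>\<close> the margin by which the decoder steps beyond it to err on a known side.
  \<open>precision\<close> bounds the combined timing error for the longest delay, and
  \<open>rate\<close> says that \<open>R\<close> allows \<open>m\<close> bits in the shortest gap
  between transmissions.\<close>

locale event_coding =
  fixes A \<sigma> \<gamma> v0 \<rho> R w \<epsilon> :: real and m :: nat
    and short_code long_code :: "real \<Rightarrow> bool list"
  assumes A_pos: "0 < A" and \<sigma>_pos: "0 < \<sigma>" and \<gamma>_nonneg: "0 \<le> \<gamma>" and v0_pos: "0 < v0"
    and \<rho>_pos: "0 < \<rho>" and \<rho>_less_1: "\<rho> < 1" and R_nonneg: "0 \<le> R"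
    and \<epsilon>_pos: "0 < \<epsilon>"
    and precision: "exp ((A + \<sigma>) * (w + \<epsilon>)) \<le> 1 + \<rho> * exp (- (\<sigma> + A) * \<gamma>)"
    and rate: "real m * (A + \<sigma>) \<le> R * - ln (\<rho> * exp (- \<sigma> * \<gamma>))"
    and length_short_code: "length (short_code t) \<le> m"
    and length_long_code: "length (long_code t) = Suc m"
    and short_code_resolution: "short_code t = short_code t' \<Longrightarrow> \<bar>t - t'\<bar> \<le> \<gamma> \<Longrightarrow> \<bar>t - t'\<bar> \<le> w"
    and long_code_resolution: "long_code t = long_code t' \<Longrightarrow> \<bar>t - t'\<bar> \<le> \<gamma> \<Longrightarrow> \<bar>t - t'\<bar> \<le> w"
begin

abbreviation v :: "real \<Rightarrow> real" where
  "v \<equiv> trig v0 \<sigma>"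

text \<open>A lower bound for the ratio of the error after a reception to \<open>v\<close> at the
  transmission, since the decoded time is off by at least \<open>\<epsilon>\<close>.\<close>

definition \<kappa> :: real where
  "\<kappa> = 1 - exp (- ((A + \<sigma>) * \<epsilon>))"

text \<open>The gap between transmissions when the packet arrives at once and leaves the largest
  admissible error; \<open>max_gap\<close> belongs to the delay \<open>\<gamma>\<close> and the
  ratio \<open>\<kappa>\<close>.\<close>

definition min_gap :: real where
  "min_gap = - ln (\<rho> * exp (- \<sigma> * \<gamma>)) / (A + \<sigma>)"

definition max_gap :: real where
  "max_gap = (A * \<gamma> - ln \<kappa>) / (A + \<sigma>)"

text \<open>While a packet is in flight, the ratio of the absolute error to \<open>v\<close> grows
  from 1 at the rate \<open>A + \<sigma>\<close>.\<close>

definition overshoot :: real where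
  "overshoot = exp ((A + \<sigma>) * \<gamma>)"

text \<open>
  Lists of transmission times are in reverse order, the current transmission coming first.
  \<open>spent\<close> is the number of bits sent so far, if all errors at transmission times are positive.
\<close>

primrec spent :: "real list \<Rightarrow> nat" where
  "spent [] = 0"
| "spent (t # ts) =
    (let a = nat \<lfloor>R * (t - last (t # ts))\<rfloor>
     in if spent ts + m < a then a else spent ts + length (short_code t))"

text \<open>\<open>a\<close> is the number of bits that the rate \<open>R\<close> allows since the
  first transmission. A deficit above \<open>m\<close> is made up by padding to a total of exactly
  \<open>a\<close> bits; a negative sign is flagged by \<open>True\<close> behind the long codeword.
  A length above \<open>m\<close> announces the long code.\<close>

definition encode :: "real list \<Rightarrow> bool \<Rightarrow> bool list" where
  "encode ts neg =
    (let a = nat \<lfloor>R * (hd ts - last ts)\<rfloor>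
     in if neg then long_code (hd ts) @ [True]
        else if spent (tl ts) + m < a
        then long_code (hd ts) @ replicate (a - spent (tl ts) - Suc m) False
        else short_code (hd ts))"

definition candidates :: "real \<Rightarrow> bool list \<Rightarrow> real set" where
  "candidates tc p = {t. tc - \<gamma> \<le> t \<and> t \<le> tc \<and>
    (if length p \<le> m then short_code t = p else long_code t = take (Suc m) p)}"

text \<open>
  The decoded value lies below all errors that are compatible with the packet, so that the error
  is positive after the reception, whatever its sign was before.
\<close>

definition decode :: decoder where
  "decode tc p =
    (if True \<in> set (drop (Suc m) p)
     then - v0 * exp (A * tc - (A + \<sigma>) * (Inf (candidates tc p) - \<epsilon>))
     else v0 * exp (A * tc - (A + \<sigma>) * (Sup (candidates tc p) + \<epsilon>)))"

section \<open>Elementary facts on the triggering function and the constants\<close>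

lemma v_pos: "0 < v t"
  using v0_pos by (simp add: trig_def)

lemma v_shift: "v t = v s * exp (- \<sigma> * (t - s))"
  by (simp add: trig_def mult.assoc flip: exp_add) (simp add: algebra_simps)

lemma v_less: "s < t \<Longrightarrow> v t < v s"
  using v0_pos \<sigma>_pos by (simp add: trig_def)

lemma \<kappa>_pos: "0 < \<kappa>"
  using A_pos \<sigma>_pos \<epsilon>_pos by (simp add: \<kappa>_def)

lemma contraction_pos: "0 < \<rho> * exp (- \<sigma> * \<gamma>)"
  using \<rho>_pos by simp

lemma contraction_less: "\<rho> * exp (- \<sigma> * \<gamma>) < exp (- \<sigma> * \<gamma>)"
  using \<rho>_less_1 by simp

lemma contraction_less_1: "\<rho> * exp (- \<sigma> * \<gamma>) < 1"
proof -
  have "exp (- \<sigma> * \<gamma>) \<le> 1"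
    using \<sigma>_pos \<gamma>_nonneg by simp
  with contraction_less show ?thesis
    by linarith
qed

lemma min_gap_pos: "0 < min_gap"
  unfolding min_gap_def using A_pos \<sigma>_pos ln_less_zero[OF contraction_pos contraction_less_1]
  by (intro divide_pos_pos) linarith+

lemma rate_min_gap: "real m \<le> R * min_gap"
  using rate A_pos \<sigma>_pos
  by (simp only: min_gap_def times_divide_eq_right pos_le_divide_eq add_pos_pos)

lemma length_encode: "length (encode (t # ts) False) + spent ts = spent (t # ts)"
  using length_long_code[of t] by (auto simp: encode_def Let_def)

section \<open>Accuracy of the decoded error\<close>

lemma mem_candidates_encode:
  assumes "t \<le> tc" "tc \<le> t + \<gamma>"
  shows "t \<in> candidates tc (encode (t # ts) neg)"
  using assms length_short_code[of t] length_long_code[of t]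
  by (auto simp: candidates_def encode_def Let_def)

text \<open>Padding consists of \<open>False\<close> only, so a \<open>True\<close> beyond the first
  \<open>Suc m\<close> bits can only be the sign flag.\<close>

lemma True_in_drop_encode: "True \<in> set (drop (Suc m) (encode (t # ts) neg)) \<longleftrightarrow> neg"
  using length_short_code[of t] length_long_code[of t]
  by (auto simp: encode_def Let_def)

lemma candidates_resolution:
  assumes "t \<in> candidates tc p" "t' \<in> candidates tc p"
  shows "\<bar>t - t'\<bar> \<le> w"
proof -
  have "\<bar>t - t'\<bar> \<le> \<gamma>"
    using assms by (auto simp: candidates_def)
  then show ?thesis
    using assms short_code_resolution[of t t'] long_code_resolution[of t t']
    by (auto simp: candidates_def split: if_splits)
qed

lemma Sup_candidates:
  assumes "t \<in> candidates tc p"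
  shows "t \<le> Sup (candidates tc p)" "Sup (candidates tc p) \<le> t + w"
proof -
  show "t \<le> Sup (candidates tc p)"
    using assms by (intro cSup_upper bdd_aboveI[of _ tc]) (auto simp: candidates_def)
  show "Sup (candidates tc p) \<le> t + w"
  proof (rule cSup_least)
    show "s \<le> t + w" if "s \<in> candidates tc p" for s
      using candidates_resolution[OF assms that] by linarith
  qed (use assms in auto)
qed

lemma Inf_candidates:
  assumes "t \<in> candidates tc p"
  shows "Inf (candidates tc p) \<le> t" "t - w \<le> Inf (candidates tc p)"
proof -
  show "Inf (candidates tc p) \<le> t"
    using assms by (intro cInf_lower bdd_belowI[of _ "tc - \<gamma>"]) (auto simp: candidates_def)
  show "t - w \<le> Inf (candidates tc p)"
  proof (rule cInf_greatest)
    show "t - w \<le> s" if "s \<in> candidates tc p" for s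
      using candidates_resolution[OF assms that] by linarith
  qed (use assms in auto)
qed

text \<open>\<open>y\<close> is the distance between the true and the decoded transmission time. The
  relative error is \<open>1 - exp (- ((A + \<sigma>) * y))\<close> for a positive sign and
  \<open>exp ((A + \<sigma>) * y) - 1\<close> for a negative one. The latter is the worse case,
  because \<open>exp u + exp (- u) \<ge> 2\<close>, and \<open>precision\<close> is tuned to
  it.\<close>

lemma relative_error:
  assumes "\<epsilon> \<le> y" "y \<le> w + \<epsilon>"
  shows "\<kappa> \<le> 1 - exp (- ((A + \<sigma>) * y))"
    and "1 - exp (- ((A + \<sigma>) * y)) \<le> exp ((A + \<sigma>) * y) - 1"
    and "exp ((A + \<sigma>) * y) - 1 \<le> \<rho> * exp (- (\<sigma> + A) * \<gamma>)"
proof -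
  let ?a = "A + \<sigma>"
  have a: "0 < ?a"
    using A_pos \<sigma>_pos by simp
  show "\<kappa> \<le> 1 - exp (- (?a * y))"
    using a assms(1) by (simp add: \<kappa>_def)
  have "2 \<le> exp (?a * y) + exp (- (?a * y))"
    using exp_ge_add_one_self[of "?a * y"] exp_ge_add_one_self[of "- (?a * y)"] by linarith
  then show "1 - exp (- (?a * y)) \<le> exp (?a * y) - 1"
    by linarith
  have "exp (?a * y) \<le> exp (?a * (w + \<epsilon>))"
    using a assms(2) by simp
  then show "exp (?a * y) - 1 \<le> \<rho> * exp (- (\<sigma> + A) * \<gamma>)"
    using precision by linarith
qed

text \<open>The decoded time \<open>q\<close> lies after \<open>t\<close> for a positive sign and
  before \<open>t\<close> for a negative one. Either way the decoded error is below the true one, by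
  the fraction \<open>e\<close> of its magnitude. Growth by at most
  \<open>exp (A * \<gamma>)\<close> during the delay cancels the factor
  \<open>exp (- A * \<gamma>)\<close> in the bound on \<open>e\<close>.\<close>

lemma residual_bounds:
  fixes t tc :: real and neg :: bool
  defines "z \<equiv> if neg then - v t else v t"
  assumes "t \<le> tc" "tc \<le> t + \<gamma>"
  shows "\<kappa> * v t \<le> z * exp (A * (tc - t)) - decode tc (encode (t # ts) neg)"
    and "z * exp (A * (tc - t)) - decode tc (encode (t # ts) neg) \<le> \<rho> * exp (- \<sigma> * \<gamma>) * v t"
proof -
  let ?p = "encode (t # ts) neg" and ?a = "A + \<sigma>"
  define q where "q = (if neg then Inf (candidates tc ?p) - \<epsilon> else Sup (candidates tc ?p) + \<epsilon>)"
  define y where "y = (if neg then t - q else q - t)"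
  define e where "e = (if neg then exp (?a * y) - 1 else 1 - exp (- (?a * y)))"
  have "\<epsilon> \<le> y" "y \<le> w + \<epsilon>"
    using Sup_candidates[OF mem_candidates_encode[OF assms(2,3)], of ts neg]
      Inf_candidates[OF mem_candidates_encode[OF assms(2,3)], of ts neg]
    by (auto simp: y_def q_def)
  note e = relative_error[OF this]
  have e_lower: "\<kappa> \<le> e" and e_upper: "e \<le> \<rho> * exp (- (\<sigma> + A) * \<gamma>)"
    unfolding e_def using e by (auto simp del: mult_minus_left)
  \<comment> \<open>The left side is the magnitude at \<open>tc\<close> of an error that met
    \<open>v\<close> at time \<open>q\<close>.\<close>
  have "v0 * exp (A * tc - ?a * q) = v t * exp (A * (tc - t)) * exp (?a * (t - q))"
    by (simp add: trig_def mult.assoc flip: exp_add) (simp add: algebra_simps)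
  also have "?a * (t - q) = (if neg then ?a * y else - (?a * y))"
    by (simp add: y_def algebra_simps)
  finally have "decode tc ?p =
      v t * exp (A * (tc - t)) * (if neg then - exp (?a * y) else exp (- (?a * y)))"
    by (cases neg) (simp_all add: decode_def True_in_drop_encode q_def)
  then have dec: "z * exp (A * (tc - t)) - decode tc ?p = v t * exp (A * (tc - t)) * e"
    by (simp add: z_def e_def right_diff_distrib)
  have "0 \<le> e"
    using e_lower \<kappa>_pos by linarith
  have "v t * \<kappa> \<le> v t * (exp (A * (tc - t)) * e)"
  proof (rule mult_left_mono)
    have "1 * \<kappa> \<le> exp (A * (tc - t)) * e"
      using e_lower \<kappa>_pos A_pos assms(2) by (intro mult_mono) auto
    then show "\<kappa> \<le> exp (A * (tc - t)) * e"
      by simp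
  qed (use v_pos[of t] in simp)
  then show "\<kappa> * v t \<le> z * exp (A * (tc - t)) - decode tc ?p"
    unfolding dec by (simp add: mult_ac)
  have "exp (A * (tc - t)) * e \<le> exp (A * \<gamma>) * (\<rho> * exp (- (\<sigma> + A) * \<gamma>))"
    using e_upper \<open>0 \<le> e\<close> A_pos assms(3) by (intro mult_mono) auto
  also have "\<dots> = \<rho> * exp (- \<sigma> * \<gamma>)"
    by (simp add: mult.left_commute flip: exp_add) (simp add: algebra_simps)
  finally have "v t * (exp (A * (tc - t)) * e) \<le> v t * (\<rho> * exp (- \<sigma> * \<gamma>))"
    using v_pos[of t] by (intro mult_left_mono) auto
  then show "z * exp (A * (tc - t)) - decode tc ?p \<le> \<rho> * exp (- \<sigma> * \<gamma>) * v t"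
    unfolding dec by (simp add: mult_ac)
qed

text \<open>After the jump the error is strictly below the triggering function again: during the
  delay \<open>v\<close> shrinks at most by the factor \<open>exp (- \<sigma> * \<gamma>)\<close>,
  and \<open>\<rho> < 1\<close>.\<close>

lemma residual_less_v:
  assumes "t \<le> tc" "tc \<le> t + \<gamma>" "\<zeta> \<le> \<rho> * exp (- \<sigma> * \<gamma>) * v t"
  shows "\<zeta> < v tc"
proof -
  have "\<zeta> < exp (- \<sigma> * \<gamma>) * v t"
    using assms(3) mult_strict_right_mono[OF contraction_less v_pos[of t]] by linarith
  also have "\<dots> \<le> exp (- \<sigma> * (tc - t)) * v t"
    using assms(2) \<sigma>_pos v_pos[of t] by (intro mult_right_mono) auto
  also have "\<dots> = v tc"
    using v_shift[of tc t] by simp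
  finally show ?thesis .
qed

section \<open>Gaps between transmissions and the bit count\<close>

text \<open>With \<open>E = \<zeta> / v t\<close>, the logarithm of the triggering equation reads
  \<open>(A + \<sigma>) * (t' - t) = A * (tc - t) - ln E\<close>, and both terms on the right are
  bounded from both sides.\<close>

lemma gap_bounds:
  assumes "t \<le> tc" "tc \<le> t + \<gamma>" "\<kappa> * v t \<le> \<zeta>" "\<zeta> \<le> \<rho> * exp (- \<sigma> * \<gamma>) * v t"
    and "v t' = \<zeta> * exp (A * (t' - tc))"
  shows "min_gap \<le> t' - t" "t' - t \<le> max_gap"
proof -
  let ?a = "A + \<sigma>"
  have a: "0 < ?a"
    using A_pos \<sigma>_pos by simp
  define E where "E = \<zeta> / v t"
  have E: "\<kappa> \<le> E" "E \<le> \<rho> * exp (- \<sigma> * \<gamma>)"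
    using assms(3,4) v_pos[of t] by (simp_all add: E_def pos_le_divide_eq pos_divide_le_eq)
  then have "0 < E"
    using \<kappa>_pos by linarith
  have "v t * exp (- \<sigma> * (t' - t)) = E * v t * exp (A * (t' - tc))"
    using assms(5) v_pos[of t] v_shift[of t' t] by (simp add: E_def)
  then have "exp (- \<sigma> * (t' - t)) = E * exp (A * (t' - tc))"
    using v_pos[of t] by simp
  then have "- \<sigma> * (t' - t) = ln (E * exp (A * (t' - tc)))"
    by (metis ln_exp)
  also have "\<dots> = ln E + A * (t' - tc)"
    using \<open>0 < E\<close> by (simp add: ln_mult)
  finally have gap: "?a * (t' - t) = A * (tc - t) - ln E"
    by (simp add: algebra_simps)
  have "ln E \<le> ln (\<rho> * exp (- \<sigma> * \<gamma>))" "ln \<kappa> \<le> ln E"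
    using E \<open>0 < E\<close> \<kappa>_pos contraction_pos by simp_all
  moreover have "0 \<le> A * (tc - t)" "A * (tc - t) \<le> A * \<gamma>"
    using assms(1,2) A_pos by auto
  ultimately have "- ln (\<rho> * exp (- \<sigma> * \<gamma>)) \<le> ?a * (t' - t)" "?a * (t' - t) \<le> A * \<gamma> - ln \<kappa>"
    using gap by linarith+
  then show "min_gap \<le> t' - t" "t' - t \<le> max_gap"
    unfolding min_gap_def max_gap_def pos_divide_le_eq[OF a] pos_le_divide_eq[OF a]
    by (simp_all only: mult.commute)
qed

text \<open>From one transmission to the next the allowance grows by at least \<open>m\<close>,
  while an unpadded packet has at most \<open>m\<close> bits, so a surplus never exceeds
  \<open>m\<close>. A deficit above \<open>m\<close> causes padding, which resets it to 0.\<close>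

lemma spent_bounds:
  assumes "ts \<noteq> []" "sorted_wrt (\<lambda>s t. t + min_gap \<le> s) ts"
  shows "\<bar>real (spent ts) - real (nat \<lfloor>R * (hd ts - last ts)\<rfloor>)\<bar> \<le> real m"
  using assms
proof (induction ts rule: list_nonempty_induct)
  case (single t)
  then show ?case
    using length_short_code[of t] by simp
next
  case (cons t ts)
  let ?a = "nat \<lfloor>R * (t - last ts)\<rfloor>" and ?a' = "nat \<lfloor>R * (hd ts - last ts)\<rfloor>"
  have IH: "\<bar>real (spent ts) - real ?a'\<bar> \<le> real m"
    using cons by auto
  have "hd ts + min_gap \<le> t"
    using cons by auto
  then have "R * (hd ts - last ts) + R * min_gap \<le> R * (t - last ts)"
    using R_nonneg mult_left_mono[of "hd ts - last ts + min_gap" "t - last ts" R]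
    by (simp add: distrib_left)
  then have "R * (hd ts - last ts) + real m \<le> R * (t - last ts)"
    using rate_min_gap by linarith
  moreover have "0 \<le> hd ts - last ts"
    using cons.hyps cons.prems min_gap_pos last_in_set[of "tl ts"] by (cases ts) fastforce+
  then have "0 \<le> R * (hd ts - last ts)"
    using R_nonneg by simp
  ultimately have "?a' + m \<le> ?a"
    by linarith
  then show ?case
    using cons.hyps IH length_short_code[of t] by (auto simp: Let_def)
qed

lemma overshoot_ge_1: "1 \<le> overshoot"
  using A_pos \<sigma>_pos \<gamma>_nonneg by (simp add: overshoot_def)

text \<open>Serves proofs by contradiction: an error that starts below \<open>v\<close> and ends
  above it has met \<open>v\<close> in between, and such a time is a transmission time.\<close>

lemma no_crossing:
  assumes "a \<le> t" "\<bar>l\<bar> < v a" "v t < \<bar>l\<bar> * exp (A * (t - a))"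
  obtains s where "a < s" "s < t" "\<bar>l\<bar> * exp (A * (s - a)) = v s"
proof -
  have "\<exists>s\<ge>a. s \<le> t \<and> \<bar>l\<bar> * exp (A * (s - a)) - v s = 0"
    using assms by (intro IVT') (auto simp: trig_def intro!: continuous_intros)
  then obtain s where s: "a \<le> s" "s \<le> t" "\<bar>l\<bar> * exp (A * (s - a)) = v s"
    by auto
  then have "s \<noteq> a" "s \<noteq> t"
    using assms by auto
  with s show ?thesis
    by (intro that[of s]) auto
qed

text \<open>The times arrive in chronological order, so \<open>last ts\<close> is the current one;
  comparing \<open>x\<close> with \<open>xh\<close> there yields the sign of the error.\<close>

definition enc :: encoder where
  "enc ts x xh = encode (rev ts) (x (last ts) < xh (last ts))"

end

subsection \<open>Behaviour of an arbitrary run\<close>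

locale coded_run = event_coding +
  fixes B K :: real and r :: run
  assumes gain: "B * K = A + \<sigma> + 1"
    and run: "closed_loop_run A B K \<gamma> v0 \<sigma> enc decode r"
    and initial_error: "\<bar>est_error r 0\<bar> < v0"
begin

abbreviation x where "x \<equiv> plant_state r"
abbreviation xh where "xh \<equiv> estimate r"
abbreviation z where "z \<equiv> est_error r"
abbreviation ts where "ts \<equiv> send_time r"
abbreviation tc where "tc \<equiv> recv_time r"
abbreviation I where "I \<equiv> trans_indices r"

definition residual :: "nat \<Rightarrow> real" where
  "residual k = z (tc k) - decode (tc k) (packet r k)"

section \<open>The error between receptions\<close>

lemma z_eq: "z t = x t - xh t"
  by (simp add: est_error_def)

lemma x_continuous: "continuous_on {0..} x"
  and x_deriv: "0 < t \<Longrightarrow> t \<notin> reception_times r \<Longrightarrow>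
      (x has_real_derivative A * x t + B * (- K * xh t)) (at t)"
  and xh_deriv: "0 < t \<Longrightarrow> t \<notin> reception_times r \<Longrightarrow>
      (xh has_real_derivative A * xh t + B * (- K * xh t)) (at t)"
  and xh_left: "0 < t \<Longrightarrow> (xh \<longlongrightarrow> xh t) (at_left t)"
  and xh_right: "0 \<le> t \<Longrightarrow> t \<notin> reception_times r \<Longrightarrow> (xh \<longlongrightarrow> xh t) (at_right t)"
  and xh_jump: "k \<in> I \<Longrightarrow> (xh \<longlongrightarrow> decode (tc k) (packet r k) + xh (tc k)) (at_right (tc k))"
  and ts_mono: "strict_mono_on I ts"
  and ts_image: "ts ` I = {t. 0 \<le> t \<and> \<bar>z t\<bar> = v t}"
  and ts_le_tc: "k \<in> I \<Longrightarrow> ts k \<le> tc k"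
  and tc_le: "k \<in> I \<Longrightarrow> tc k \<le> ts k + \<gamma>"
  and packet_eq: "k \<in> I \<Longrightarrow> packet r k =
      enc (map ts [0..<Suc k]) (restrict x {0..ts k}) (restrict xh {0..ts k})"
  using run by (auto simp: closed_loop_run_def Let_def)

lemma I_downward: "k \<in> I \<Longrightarrow> j \<le> k \<Longrightarrow> j \<in> I"
  by (auto simp: trans_indices_def) (metis enat_ord_simps(1) order_le_less_trans)

lemma ts_less: "k \<in> I \<Longrightarrow> j < k \<Longrightarrow> ts j < ts k"
  using ts_mono I_downward[of k j] by (auto simp: strict_mono_on_def)

lemma ts_le: "k \<in> I \<Longrightarrow> j \<le> k \<Longrightarrow> ts j \<le> ts k"
  using ts_less[of k j] by (cases "j = k") auto

lemma trigger: "k \<in> I \<Longrightarrow> \<bar>z (ts k)\<bar> = v (ts k)"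
  using ts_image by blast

lemma ts_pos: "k \<in> I \<Longrightarrow> 0 < ts k"
proof -
  assume k: "k \<in> I"
  then have "0 \<le> ts k"
    using ts_image by blast
  moreover have "ts k \<noteq> 0"
    using trigger[OF k] initial_error by (auto simp: trig_def)
  ultimately show ?thesis
    by simp
qed

lemma trigger_index:
  assumes "0 \<le> t" "\<bar>z t\<bar> = v t"
  obtains k where "k \<in> I" "ts k = t"
proof -
  have "t \<in> ts ` I"
    unfolding ts_image using assms by simp
  then show ?thesis
    using that by auto
qed

lemma z_deriv:
  assumes "0 < t" "t \<notin> reception_times r"
  shows "(z has_real_derivative A * z t) (at t)"
proof -
  have "((\<lambda>t. x t - xh t) has_real_derivative A * z t) (at t)"
    by (rule derivative_eq_intros x_deriv[OF assms] xh_deriv[OF assms])+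
      (simp add: z_eq algebra_simps)
  then show ?thesis
    by (simp add: z_eq[abs_def])
qed

lemma x_right: "0 \<le> t \<Longrightarrow> (x \<longlongrightarrow> x t) (at_right t)"
  using x_continuous tendsto_within_subset[of x "nhds (x t)" t "{0..}" "{t<..}"]
  by (simp add: continuous_on subset_eq)

lemma x_left:
  assumes "0 < t"
  shows "(x \<longlongrightarrow> x t) (at_left t)"
proof -
  have "isCont x t"
    using continuous_on_interior[OF x_continuous, of t] assms by (simp add: interior_Ici[of "-1"])
  then show ?thesis
    by (simp add: continuous_within filterlim_at_split)
qed

lemma z_left: "0 < t \<Longrightarrow> (z \<longlongrightarrow> z t) (at_left t)"
  unfolding z_eq[abs_def] by (intro tendsto_diff x_left xh_left)

lemma z_right: "0 \<le> t \<Longrightarrow> t \<notin> reception_times r \<Longrightarrow> (z \<longlongrightarrow> z t) (at_right t)"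
  unfolding z_eq[abs_def] by (intro tendsto_diff x_right xh_right)

lemma z_jump:
  assumes "k \<in> I"
  shows "(z \<longlongrightarrow> residual k) (at_right (tc k))"
proof -
  have "((\<lambda>t. x t - xh t) \<longlongrightarrow> x (tc k) - (decode (tc k) (packet r k) + xh (tc k))) (at_right (tc k))"
    using ts_pos[OF assms] ts_le_tc[OF assms] by (intro tendsto_diff x_right xh_jump assms) simp
  then show ?thesis
    by (simp add: residual_def z_eq[abs_def] algebra_simps)
qed

text \<open>\<open>l\<close> is the value after a possible jump at \<open>a\<close>, so it need not
  be \<open>z a\<close>; hence the separate premise for \<open>a = t\<close>.\<close>

lemma z_exp:
  assumes "0 \<le> a" "a \<le> t" "(z \<longlongrightarrow> l) (at_right a)" "a = t \<Longrightarrow> z t = l"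
    and "\<And>j. j \<in> I \<Longrightarrow> a < tc j \<Longrightarrow> t \<le> tc j"
  shows "z t = l * exp (A * (t - a))"
proof (cases "a = t")
  case False
  show ?thesis
  proof (rule exp_ode_solution)
    show "(z has_real_derivative A * z s) (at s)" if "a < s" "s < t" for s
      using assms that by (intro z_deriv) (force simp: reception_times_def)+
  qed (use False assms z_left[of t] in auto)
qed (use assms in auto)

lemma enc_packet:
  assumes "k \<in> I"
  shows "packet r k = encode (ts k # rev (map ts [0..<k])) (z (ts k) < 0)"
  using packet_eq[OF assms] ts_pos[OF assms] by (simp add: enc_def z_eq)

section \<open>Alternation of transmissions and receptions\<close>

text \<open>The induction invariant. Neither clause is part of the definition of a run; both result
  from the coding.\<close>

definition regular :: "nat \<Rightarrow> bool" where
  "regular k \<longleftrightarrow> (\<forall>j<k. tc j < ts k) \<and> (0 < k \<longrightarrow> 0 < z (ts k))"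

lemma regularD: "regular k \<Longrightarrow> j < k \<Longrightarrow> tc j < ts k"
  by (simp add: regular_def)

text \<open>No other packet is received during the flight: earlier ones have arrived by the
  invariant, later ones are not sent before \<open>t\<close>. The premise on
  \<open>ts (Suc k)\<close> stands in for \<open>tc k < ts (Suc k)\<close>, which is derived from
  this lemma afterwards.\<close>

lemma flight:
  assumes "k \<in> I" "regular k" "ts k \<le> t" "t \<le> tc k" "Suc k \<in> I \<Longrightarrow> t \<le> ts (Suc k)"
  shows "z t = z (ts k) * exp (A * (t - ts k))"
\<comment> \<open>\<open>ts k = t\<close> is set apart because with zero delay \<open>ts k\<close>
  is a reception time, where the right limit is the value after the jump.\<close>
proof (cases "ts k = t")
  case False
  have later: "t \<le> tc j" if "j \<in> I" "k \<le> j" for j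
  proof (cases "j = k")
    case False
    with that have "Suc k \<le> j"
      by simp
    then have "t \<le> ts j"
      using assms(5) I_downward[OF that(1)] ts_le[OF that(1), of "Suc k"] by force
    then show ?thesis
      using ts_le_tc[OF that(1)] by linarith
  qed (use assms in simp)
  have earlier: "tc j < ts k" if "j < k" for j
    using that assms(2) by (simp add: regular_def)
  have "ts k \<notin> reception_times r"
  proof
    assume "ts k \<in> reception_times r"
    then obtain j where "j \<in> I" "ts k = tc j"
      by (auto simp: reception_times_def)
    then show False
      using False assms(3) later[of j] earlier[of j] by (cases "j < k") auto
  qed
  then show ?thesis
    using assms(1,3) ts_pos[of k] later earlier
    by (intro z_exp z_right) (auto simp: not_less intro: leI dest: less_asym)
qed simp

text \<open>In flight the absolute error grows from \<open>v (ts k)\<close> while \<open>v\<close>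
  decreases, so they cannot meet again before the reception.\<close>

lemma recv_before_next:
  assumes "Suc k \<in> I" "regular k"
  shows "tc k < ts (Suc k)"
proof (rule ccontr)
  assume "\<not> tc k < ts (Suc k)"
  moreover have k: "k \<in> I" and less: "ts k < ts (Suc k)"
    using I_downward ts_less assms(1) by auto
  ultimately have "z (ts (Suc k)) = z (ts k) * exp (A * (ts (Suc k) - ts k))"
    using assms by (intro flight) auto
  then have "v (ts (Suc k)) = v (ts k) * exp (A * (ts (Suc k) - ts k))"
    using trigger[OF k] trigger[OF assms(1)] by (simp add: abs_mult)
  moreover have "1 < exp (A * (ts (Suc k) - ts k))"
    using A_pos less by simp
  ultimately show False
    using v_less[OF less] v_pos[of "ts k"] by (smt (verit) mult_less_cancel_left2)
qed

lemma residual_range: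
  assumes "k \<in> I" "regular k"
  shows "\<kappa> * v (ts k) \<le> residual k" "residual k \<le> \<rho> * exp (- \<sigma> * \<gamma>) * v (ts k)"
proof -
  have "z (tc k) = z (ts k) * exp (A * (tc k - ts k))"
    using assms ts_le_tc less_imp_le[OF recv_before_next] by (intro flight) auto
  moreover have "z (ts k) = (if z (ts k) < 0 then - v (ts k) else v (ts k))"
    using trigger[OF assms(1)] by auto
  ultimately show "\<kappa> * v (ts k) \<le> residual k"
    "residual k \<le> \<rho> * exp (- \<sigma> * \<gamma>) * v (ts k)"
    using residual_bounds[OF ts_le_tc tc_le, OF assms(1) assms(1),
        of "z (ts k) < 0" "rev (map ts [0..<k])"]
    by (simp_all add: residual_def enc_packet[OF assms(1)])
qed

lemma residual_pos: "k \<in> I \<Longrightarrow> regular k \<Longrightarrow> 0 < residual k"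
  using residual_range(1)[of k] \<kappa>_pos v_pos[of "ts k"] by (smt (verit) mult_pos_pos)

lemma coast:
  assumes "k \<in> I" "regular k" "tc k < t" "Suc k \<in> I \<Longrightarrow> t \<le> ts (Suc k)"
  shows "z t = residual k * exp (A * (t - tc k))"
proof (rule z_exp[OF _ _ z_jump])
  show "t \<le> tc j" if "j \<in> I" "tc k < tc j" for j
  proof (cases "j \<le> k")
    case True
    then have "tc j \<le> tc k"
      using assms(2) ts_le_tc[OF assms(1)] regularD[of k j] by (cases "j = k") auto
    then show ?thesis
      using that by simp
  next
    case False
    then have "Suc k \<le> j"
      by simp
    then show ?thesis
      using assms(4) I_downward[OF that(1)] ts_le[OF that(1), of "Suc k"] ts_le_tc[OF that(1)]
      by fastforce
  qed
qed (use assms ts_pos[of k] ts_le_tc[of k] in auto)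

text \<open>Every reception leaves a positive error, whatever the sign before, and exponential
  growth up to the next transmission keeps it positive.\<close>

lemma regular: "k \<in> I \<Longrightarrow> regular k"
proof (induction k)
  case (Suc k)
  then have k: "k \<in> I" "regular k"
    using I_downward by auto
  have next_recv: "tc k < ts (Suc k)"
    using Suc.prems k by (intro recv_before_next)
  have "tc j < ts (Suc k)" if "j < Suc k" for j
    using that next_recv ts_le_tc[OF k(1)] regularD[OF k(2), of j] by (cases "j = k") auto
  moreover have "z (ts (Suc k)) = residual k * exp (A * (ts (Suc k) - tc k))"
    using k next_recv by (intro coast) auto
  then have "0 < z (ts (Suc k))"
    using residual_pos[OF k] by simp
  ultimately show ?case
    by (simp add: regular_def)
qed (simp add: regular_def)

lemma right_limit_recv:
  assumes "k \<in> I"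
  shows "\<bar>right_limit z (tc k)\<bar> \<le> \<rho> * exp (- \<sigma> * \<gamma>) * v (ts k)"
proof -
  have "right_limit z (tc k) = residual k"
    unfolding right_limit_def by (intro tendsto_Lim z_jump assms) simp
  then show ?thesis
    using residual_range(2) residual_pos regular[OF assms] assms by fastforce
qed

lemma gap:
  assumes "Suc k \<in> I"
  shows "min_gap \<le> ts (Suc k) - ts k" "ts (Suc k) - ts k \<le> max_gap"
proof -
  have k: "k \<in> I" "regular k"
    using I_downward[OF assms] regular by auto
  have "z (ts (Suc k)) = residual k * exp (A * (ts (Suc k) - tc k))"
    using k recv_before_next[OF assms k(2)] by (intro coast) auto
  moreover have "z (ts (Suc k)) = v (ts (Suc k))"
    using trigger[OF assms] regular[OF assms] by (simp add: regular_def)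
  ultimately have "v (ts (Suc k)) = residual k * exp (A * (ts (Suc k) - tc k))"
    by simp
  from gap_bounds[OF ts_le_tc[OF k(1)] tc_le[OF k(1)] residual_range[OF k] this]
  show "min_gap \<le> ts (Suc k) - ts k" "ts (Suc k) - ts k \<le> max_gap" .
qed

section \<open>Bounds on the error and on the state\<close>

lemma ts_growth: "k \<in> I \<Longrightarrow> ts 0 + real k * min_gap \<le> ts k"
proof (induction k)
  case (Suc k)
  then show ?case
    using gap(1)[of k] I_downward[of "Suc k" k] by (simp add: distrib_right)
qed simp

text \<open>Transmissions cannot accumulate, because consecutive ones are at least
  \<open>min_gap\<close> apart.\<close>

lemma finite_ts_less: "finite {k \<in> I. ts k < t}"
proof (rule finite_subset)
  show "{k \<in> I. ts k < t} \<subseteq> {..nat \<lceil>t / min_gap\<rceil>}"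
  proof
    fix k assume "k \<in> {k \<in> I. ts k < t}"
    then have k: "k \<in> I" "ts k < t"
      by auto
    then have "real k * min_gap \<le> t"
      using ts_growth[of k] ts_pos[OF I_downward[OF k(1), of 0]] by simp
    then have "real k \<le> t / min_gap"
      using min_gap_pos by (simp add: pos_le_divide_eq)
    then show "k \<in> {..nat \<lceil>t / min_gap\<rceil>}"
      by simp linarith
  qed
qed simp

lemma z_before_first:
  assumes "0 \<le> t" "\<And>k. k \<in> I \<Longrightarrow> t \<le> ts k"
  shows "z t = z 0 * exp (A * t)"
proof -
  have "0 \<notin> reception_times r"
    using ts_pos ts_le_tc by (force simp: reception_times_def)
  then have "z t = z 0 * exp (A * (t - 0))"
    using assms ts_le_tc by (intro z_exp z_right) (force dest: order_trans)+
  then show ?thesis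
    by simp
qed

text \<open>Before the first transmission and after a reception the absolute error cannot exceed
  \<open>v\<close>, since the crossing would be a further transmission. In flight, for a time of at
  most \<open>\<gamma>\<close>, it exceeds \<open>v\<close> at most by the factor
  \<open>overshoot\<close>.\<close>

lemma z_bound:
  assumes "0 \<le> t"
  shows "\<bar>z t\<bar> \<le> overshoot * v t"
proof (cases "\<exists>k\<in>I. ts k < t")
  case False
  then have before: "z s = z 0 * exp (A * (s - 0))" if "0 \<le> s" "s \<le> t" for s
    using that z_before_first[of s] by force
  have "\<bar>z t\<bar> \<le> v t"
  proof (rule ccontr)
    assume "\<not> \<bar>z t\<bar> \<le> v t"
    then obtain s where "0 < s" "s < t" "\<bar>z 0\<bar> * exp (A * (s - 0)) = v s"
      using no_crossing[of 0 t "z 0"] assms before[of t] initial_error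
      by (auto simp: abs_mult trig_def)
    then show False
      using before[of s] trigger_index[of s] False by (auto simp: abs_mult)
  qed
  then show ?thesis
    using overshoot_ge_1 v_pos[of t] by (smt (verit) mult_le_cancel_right1)
next
  case True
  define k where "k = Max {k \<in> I. ts k < t}"
  have k: "k \<in> I" "ts k < t"
    using Max_in[OF finite_ts_less[of t]] True by (auto simp: k_def)
  have max: "t \<le> ts j" if "j \<in> I" "k < j" for j
    using that Max_ge[OF finite_ts_less[of t], of j] by (force simp: k_def)
  note reg = regular[OF k(1)]
  show ?thesis
  proof (cases "t \<le> tc k")
    case True
    have "\<bar>z t\<bar> = \<bar>z (ts k) * exp (A * (t - ts k))\<bar>"
      using k reg True max by (subst flight[of k t]) auto
    also have "\<dots> = v t * exp ((A + \<sigma>) * (t - ts k))"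
      by (simp add: abs_mult trigger[OF k(1)])
        (simp add: trig_def mult.assoc algebra_simps flip: exp_add)
    also have "\<dots> \<le> v t * overshoot"
      unfolding overshoot_def using True tc_le[OF k(1)] A_pos \<sigma>_pos v_pos[of t]
      by (intro mult_left_mono) auto
    finally show ?thesis
      by (simp add: mult.commute)
  next
    case False
    then have after: "z s = residual k * exp (A * (s - tc k))" if "tc k < s" "s \<le> t" for s
      using that k reg max by (intro coast) force+
    have small: "\<bar>residual k\<bar> < v (tc k)"
      using residual_less_v[OF ts_le_tc tc_le residual_range(2)] k reg residual_pos[of k] by auto
    have "\<bar>z t\<bar> \<le> v t"
    proof (rule ccontr)
      assume "\<not> \<bar>z t\<bar> \<le> v t"
      then obtain s where s: "tc k < s" "s < t" "\<bar>residual k\<bar> * exp (A * (s - tc k)) = v s"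
        using no_crossing[of "tc k" t "residual k"] False after[of t] small
        by (auto simp: abs_mult)
      moreover have "0 < s"
        using s ts_pos[OF k(1)] ts_le_tc[OF k(1)] by linarith
      ultimately obtain j where "j \<in> I" "ts j = s"
        using after[of s] trigger_index[of s] by (auto simp: abs_mult)
      then show False
        using s max[of j] ts_le[OF k(1), of j] ts_le_tc[OF k(1)] by (cases "k < j") auto
    qed
    then show ?thesis
      using overshoot_ge_1 v_pos[of t] by (smt (verit) mult_le_cancel_right1)
  qed
qed

text \<open>The decay rate \<open>\<mu>\<close> is left open: convergence uses
  \<open>\<mu> = \<sigma>\<close>, stability uses \<open>\<mu> = 0\<close>.\<close>

lemma state_bound:
  assumes "0 \<le> t" "\<mu> \<le> \<sigma>" and z: "\<And>s. 0 \<le> s \<Longrightarrow> s \<le> t \<Longrightarrow> \<bar>z s\<bar> \<le> E * exp (- \<mu> * s)"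
  shows "\<bar>x t\<bar> \<le> \<bar>x 0\<bar> * exp (- (\<sigma> + 1) * t) + (A + \<sigma> + 1) * E / (\<sigma> + 1 - \<mu>) * exp (- \<mu> * t)"
proof (rule perturbed_linear_ode_bound)
  \<comment> \<open>Packets sent at \<open>t\<close> or later are received at \<open>t\<close> or
    later, so this finite set contains all receptions before \<open>t\<close>.\<close>
  show "finite (tc ` {k \<in> I. ts k < t})"
    by (intro finite_imageI finite_ts_less)
  show "(x has_real_derivative - (\<sigma> + 1) * x s + (A + \<sigma> + 1) * z s) (at s)"
    if "0 < s" "s < t" "s \<notin> tc ` {k \<in> I. ts k < t}" for s
  proof -
    have "s \<notin> reception_times r"
      using that ts_le_tc by (force simp: reception_times_def)
    moreover have "A * x s + B * (- K * xh s) = - (\<sigma> + 1) * x s + (A + \<sigma> + 1) * z s"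
      using gain by (simp add: z_eq algebra_simps flip: mult.assoc)
    ultimately show ?thesis
      using x_deriv[of s] that by simp
  qed
qed (use assms A_pos \<sigma>_pos in \<open>auto intro: continuous_on_subset[OF x_continuous]\<close>)

lemma state_tendsto_0: "(x \<longlongrightarrow> 0) at_top"
proof (rule Lim_null_comparison)
  let ?E = "overshoot * v0"
  show "\<forall>\<^sub>F t in at_top. norm (x t) \<le>
      \<bar>x 0\<bar> * exp (- (\<sigma> + 1) * t) + (A + \<sigma> + 1) * ?E / (\<sigma> + 1 - \<sigma>) * exp (- \<sigma> * t)"
    using eventually_ge_at_top[of 0]
  proof eventually_elim
    case (elim t)
    then show ?case
      using state_bound[of t \<sigma> ?E] z_bound by (simp add: trig_def mult.assoc)
  qed
  show "((\<lambda>t. \<bar>x 0\<bar> * exp (- (\<sigma> + 1) * t) +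
      (A + \<sigma> + 1) * ?E / (\<sigma> + 1 - \<sigma>) * exp (- \<sigma> * t)) \<longlongrightarrow> 0) at_top"
    using \<sigma>_pos by (intro tendsto_add_zero tendsto_mult_right_zero tendsto_exp_neg_at_top) auto
qed

text \<open>
  The smaller the initial error, the later the first transmission; and from then on the error is
  at most a multiple of the triggering function.
\<close>

lemma state_small:
  assumes "0 \<le> T" "\<bar>z 0\<bar> * exp (A * T) < v T" "0 \<le> t"
  shows "\<bar>x t\<bar> \<le> \<bar>x 0\<bar> + (A + \<sigma> + 1) * (overshoot * v T)"
proof -
  have first: "T \<le> ts k" if "k \<in> I" for k
  proof (rule ccontr)
    assume "\<not> T \<le> ts k"
    have "0 \<in> I"
      using that I_downward by simp
    then have "ts 0 < T" "0 < ts 0"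
      using \<open>\<not> T \<le> ts k\<close> ts_le[OF that, of 0] ts_pos by auto
    have "z (ts 0) = z 0 * exp (A * ts 0)"
      using ts_le \<open>0 < ts 0\<close> by (intro z_before_first) auto
    then have "v (ts 0) = \<bar>z 0\<bar> * exp (A * ts 0)"
      using trigger[OF \<open>0 \<in> I\<close>] by (simp add: abs_mult)
    also have "\<dots> \<le> \<bar>z 0\<bar> * exp (A * T)"
      using \<open>ts 0 < T\<close> A_pos by (intro mult_left_mono) auto
    also have "\<dots> < v T"
      by (rule assms)
    finally show False
      using v_less[OF \<open>ts 0 < T\<close>] by linarith
  qed
  have z: "\<bar>z s\<bar> \<le> overshoot * v T" if "0 \<le> s" for s
  proof (cases "s \<le> T")
    case True
    then have "z s = z 0 * exp (A * s)"
      using that first by (intro z_before_first) force+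
    then have "\<bar>z s\<bar> = \<bar>z 0\<bar> * exp (A * s)"
      by (simp add: abs_mult)
    also have "\<dots> \<le> \<bar>z 0\<bar> * exp (A * T)"
      using True A_pos by (intro mult_left_mono) auto
    also have "\<dots> \<le> 1 * v T"
      using assms(2) by simp
    also have "\<dots> \<le> overshoot * v T"
      using overshoot_ge_1 v_pos[of T] by (intro mult_right_mono) auto
    finally show ?thesis .
  next
    case False
    then have "\<bar>z s\<bar> \<le> overshoot * v s"
      using that by (intro z_bound)
    also have "\<dots> \<le> overshoot * v T"
      using False v_less[of T s] overshoot_ge_1 by (intro mult_left_mono) auto
    finally show ?thesis .
  qed
  have "\<bar>x t\<bar> \<le> \<bar>x 0\<bar> * exp (- (\<sigma> + 1) * t) + (A + \<sigma> + 1) * (overshoot * v T) / (\<sigma> + 1)"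
    using state_bound[of t 0 "overshoot * v T"] z assms(3) \<sigma>_pos by simp
  also have "\<dots> \<le> \<bar>x 0\<bar> * 1 + (A + \<sigma> + 1) * (overshoot * v T) / 1"
    using A_pos \<sigma>_pos assms(3) overshoot_ge_1 v_pos[of T]
    by (intro add_mono mult_left_mono divide_left_mono) (auto intro: mult_nonneg_nonneg simp: mult_le_0_iff)
  finally show ?thesis
    by simp
qed

end

section \<open>The information transmission rate\<close>

context coded_run
begin

text \<open>\<open>W\<close> counts the bits as if all errors were positive, so only the first
  packet can deviate from it. Hence the bits sent stay within a constant of \<open>R\<close> times
  the elapsed time, which is unbounded, and the quotient even converges.\<close>

lemma info_rate_eq:
  assumes "num_trans r = \<infinity>"
  shows "info_rate r = ereal R"
proof -
  have I: "k \<in> I" for k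
    using assms by (simp add: trans_indices_def)
  define W where "W n = spent (rev (map ts [0..<n]))" for n
  define len where "len k = real (length (packet r k))" for k
  have len: "len k + real (W k) = real (W (Suc k))" if "0 < k" for k
  proof -
    have "0 < z (ts k)"
      using regular[OF I] that by (simp add: regular_def)
    then show ?thesis
      using length_encode[of "ts k" "rev (map ts [0..<k])"]
      by (simp add: len_def enc_packet[OF I] W_def not_less del: spent.simps flip: of_nat_add)
  qed
  have sum_len: "(\<Sum>k<Suc n. len k) + real (W 1) = real (W (Suc n)) + len 0" for n
  proof (induction n)
    case (Suc n)
    then show ?case
      using len[of "Suc n"] by simp
  qed simp
  have gaps: "ts i + min_gap \<le> ts j" if "i < j" for i j
  proof -
    have "ts i + min_gap \<le> ts (Suc i)"
      using gap(1)[OF I, of i] by simp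
    also have "\<dots> \<le> ts j"
      using that by (intro ts_le I) simp
    finally show ?thesis .
  qed
  have W: "\<bar>real (W (Suc n)) - real (nat \<lfloor>R * (ts n - ts 0)\<rfloor>)\<bar> \<le> real m" for n
  proof -
    let ?ts = "rev (map ts [0..<Suc n])"
    have "sorted_wrt (\<lambda>s t. t + min_gap \<le> s) ?ts"
      unfolding sorted_wrt_rev unfolding sorted_wrt_iff_nth_less using gaps
      by (auto simp del: upt_Suc)
    moreover have "hd ?ts = ts n"
      by simp
    moreover have "last ?ts = ts 0"
      by (simp add: last_rev hd_map del: upt_Suc)
    ultimately show ?thesis
      using spent_bounds[of ?ts] by (simp add: W_def del: spent.simps)
  qed
  \<comment> \<open>The terms account for the tolerance of the bit count, the rounding of the
    allowance, the gap from \<open>ts n\<close> to \<open>ts (Suc n)\<close> that only the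
    denominator contains, and the first packet.\<close>
  define C where "C = real m + 1 + R * max_gap + \<bar>len 0 - real (W 1)\<bar>"
  have numerator: "\<bar>(\<Sum>k<Suc n. len k) - R * (ts (Suc n) - ts 0)\<bar> \<le> C" for n
  proof -
    have "0 \<le> R * (ts n - ts 0)"
      using ts_le[OF I, of 0 n] R_nonneg by simp
    then have "\<bar>real (nat \<lfloor>R * (ts n - ts 0)\<rfloor>) - R * (ts n - ts 0)\<bar> \<le> 1"
      by linarith
    moreover have "R * (ts (Suc n) - ts 0) = R * (ts (Suc n) - ts n) + R * (ts n - ts 0)"
      by (simp add: algebra_simps)
    moreover have "0 \<le> R * (ts (Suc n) - ts n)" "R * (ts (Suc n) - ts n) \<le> R * max_gap"
      using gap[OF I, of n] min_gap_pos R_nonneg by (auto intro: mult_left_mono)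
    ultimately show ?thesis
      using sum_len[of n] W[of n] unfolding C_def by linarith
  qed
  define q where "q N = (\<Sum>k<N. len k) / (\<Sum>k<N. ts (Suc k) - ts k)" for N
  have "(\<lambda>n. q (Suc n) - R) \<longlonglongrightarrow> 0"
  proof (rule Lim_null_comparison)
    show "\<forall>\<^sub>F n in sequentially. norm (q (Suc n) - R) \<le> C / min_gap / real (Suc n)"
    proof (intro always_eventually allI)
      fix n
      let ?d = "ts (Suc n) - ts 0"
      have d: "real (Suc n) * min_gap \<le> ?d"
        using ts_growth[OF I, of "Suc n"] by linarith
      have pos: "0 < real (Suc n) * min_gap"
        using min_gap_pos by simp
      have "q (Suc n) - R = ((\<Sum>k<Suc n. len k) - R * ?d) / ?d"
        unfolding q_def sum_lessThan_telescope using d pos by (simp add: diff_divide_distrib del: sum.lessThan_Suc)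
      then have "norm (q (Suc n) - R) = \<bar>(\<Sum>k<Suc n. len k) - R * ?d\<bar> / ?d"
        using d pos by simp
      also have "\<dots> \<le> C / (real (Suc n) * min_gap)"
        using numerator[of n] d pos by (intro frac_le) auto
      finally show "norm (q (Suc n) - R) \<le> C / min_gap / real (Suc n)"
        by (simp add: mult.commute)
    qed
    show "(\<lambda>n. C / min_gap / real (Suc n)) \<longlonglongrightarrow> 0"
      using LIMSEQ_Suc[OF lim_const_over_n] .
  qed
  then have "q \<longlonglongrightarrow> R"
    by (simp add: LIM_zero_iff filterlim_sequentially_Suc)
  then have "(\<lambda>N. ereal (q N)) \<longlonglongrightarrow> ereal R"
    by simp
  then show ?thesis
    unfolding info_rate_def q_def len_def by (intro lim_imp_Limsup) simp_all
qed

end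

subsection \<open>Existence of runs\<close>

locale time_partition =
  fixes \<tau> :: "nat \<Rightarrow> real"
  assumes strict_mono: "strict_mono \<tau>" and unbounded: "\<exists>k. t \<le> \<tau> k"
begin

text \<open>Cells are closed on the right because the estimate is left-continuous. The first one
  reaches down to minus infinity, so the cells cover the line and \<open>\<tau> 0\<close> is no
  breakpoint.\<close>

definition cell :: "nat \<Rightarrow> real set" where
  "cell k = (if k = 0 then {..\<tau> (Suc k)} else {\<tau> k<..\<tau> (Suc k)})"

text \<open>For \<open>0 < k\<close>, \<open>Y k\<close> is the limit from the right at
  \<open>\<tau> k\<close>, whereas the value at that point belongs to the preceding cell.\<close>

definition piecewise_exp :: "real \<Rightarrow> (nat \<Rightarrow> real) \<Rightarrow> real \<Rightarrow> real" where
  "piecewise_exp \<alpha> Y t = (let k = LEAST k. t \<le> \<tau> (Suc k) in Y k * exp (\<alpha> * (t - \<tau> k)))"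

lemma cell_exists: obtains k where "t \<in> cell k"
proof -
  obtain j where "t \<le> \<tau> j"
    using unbounded by blast
  also have "\<dots> \<le> \<tau> (Suc j)"
    using strict_mono by (simp add: strict_mono_less_eq)
  finally have j: "t \<le> \<tau> (Suc j)" .
  define k where "k = (LEAST k. t \<le> \<tau> (Suc k))"
  have "t \<le> \<tau> (Suc k)"
    unfolding k_def using j by (rule LeastI)
  moreover have "\<tau> k < t" if "k \<noteq> 0"
    using that not_less_Least[of "k - 1" "\<lambda>k. t \<le> \<tau> (Suc k)"] by (auto simp flip: k_def)
  ultimately show ?thesis
    using that[of k] by (cases "k = 0") (auto simp: cell_def)
qed

lemma piecewise_exp_cell:
  assumes "t \<in> cell k"
  shows "piecewise_exp \<alpha> Y t = Y k * exp (\<alpha> * (t - \<tau> k))"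
proof -
  have "(LEAST k. t \<le> \<tau> (Suc k)) = k"
  proof (rule Least_equality)
    show "t \<le> \<tau> (Suc k)"
      using assms by (auto simp: cell_def split: if_splits)
    show "k \<le> j" if "t \<le> \<tau> (Suc j)" for j
    proof (rule ccontr)
      assume "\<not> k \<le> j"
      then have "\<tau> (Suc j) \<le> \<tau> k"
        using strict_mono by (simp add: strict_mono_less_eq)
      then show False
        using that assms \<open>\<not> k \<le> j\<close> by (auto simp: cell_def split: if_splits)
    qed
  qed
  then show ?thesis
    by (simp add: piecewise_exp_def)
qed

lemma deriv_piecewise_exp:
  assumes "\<And>k. t \<noteq> \<tau> (Suc k)"
  shows "(piecewise_exp \<alpha> Y has_real_derivative \<alpha> * piecewise_exp \<alpha> Y t) (at t)"
proof -
  obtain k where k: "t \<in> cell k"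
    by (rule cell_exists)
  let ?S = "if k = 0 then {..<\<tau> (Suc k)} else {\<tau> k<..<\<tau> (Suc k)}"
  show ?thesis
  proof (rule has_field_derivative_transform_within_open)
    show "((\<lambda>t. Y k * exp (\<alpha> * (t - \<tau> k))) has_real_derivative \<alpha> * piecewise_exp \<alpha> Y t) (at t)"
      by (auto intro!: derivative_eq_intros simp: piecewise_exp_cell[OF k])
    show "open ?S"
      by simp
    show "t \<in> ?S"
      using k assms[of k] by (cases "k = 0") (simp_all add: cell_def)
    show "Y k * exp (\<alpha> * (s - \<tau> k)) = piecewise_exp \<alpha> Y s" if "s \<in> ?S" for s
    proof -
      have "s \<in> cell k"
        using that by (auto simp: cell_def split: if_splits)
      then show ?thesis
        by (simp add: piecewise_exp_cell)
    qed
  qed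
qed

lemma piecewise_exp_left: "(piecewise_exp \<alpha> Y \<longlongrightarrow> piecewise_exp \<alpha> Y t) (at_left t)"
proof -
  obtain k where k: "t \<in> cell k"
    by (rule cell_exists)
  define a where "a = (if k = 0 then t - 1 else \<tau> k)"
  have "a < t"
    using k by (auto simp: a_def cell_def)
  have "\<forall>\<^sub>F s in at_left t. s \<in> cell k"
    unfolding eventually_at_left[OF \<open>a < t\<close>] using k \<open>a < t\<close>
    by (intro exI[of _ a]) (auto simp: cell_def a_def split: if_splits)
  then have "\<forall>\<^sub>F s in at_left t. Y k * exp (\<alpha> * (s - \<tau> k)) = piecewise_exp \<alpha> Y s"
    by eventually_elim (simp add: piecewise_exp_cell)
  moreover have "((\<lambda>s. Y k * exp (\<alpha> * (s - \<tau> k))) \<longlongrightarrow> Y k * exp (\<alpha> * (t - \<tau> k))) (at_left t)"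
    by (intro tendsto_intros)
  ultimately show ?thesis
    using tendsto_cong by (simp add: piecewise_exp_cell[OF k]) fast
qed

lemma piecewise_exp_right:
  assumes "\<And>k. t \<noteq> \<tau> (Suc k)"
  shows "(piecewise_exp \<alpha> Y \<longlongrightarrow> piecewise_exp \<alpha> Y t) (at_right t)"
  using DERIV_isCont[OF deriv_piecewise_exp[OF assms]]
  by (simp add: continuous_within filterlim_at_split)

lemma piecewise_exp_jump: "(piecewise_exp \<alpha> Y \<longlongrightarrow> Y (Suc k)) (at_right (\<tau> (Suc k)))"
proof -
  have less: "\<tau> (Suc k) < \<tau> (Suc (Suc k))"
    using strict_mono by (simp add: strict_mono_less)
  have "\<forall>\<^sub>F s in at_right (\<tau> (Suc k)). s \<in> cell (Suc k)"
    unfolding eventually_at_right[OF less] using less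
    by (intro exI[of _ "\<tau> (Suc (Suc k))"]) (auto simp: cell_def)
  then have "\<forall>\<^sub>F s in at_right (\<tau> (Suc k)).
      Y (Suc k) * exp (\<alpha> * (s - \<tau> (Suc k))) = piecewise_exp \<alpha> Y s"
    by eventually_elim (simp add: piecewise_exp_cell)
  moreover have "((\<lambda>s. Y (Suc k) * exp (\<alpha> * (s - \<tau> (Suc k)))) \<longlongrightarrow>
      Y (Suc k) * exp (\<alpha> * (\<tau> (Suc k) - \<tau> (Suc k)))) (at_right (\<tau> (Suc k)))"
    by (intro tendsto_intros)
  ultimately show ?thesis
    using tendsto_cong by simp fast
qed

end

section \<open>Trajectories with prescribed delays\<close>

context event_coding
begin

text \<open>The solution \<open>t\<close> of the triggering equation for an error that equals
  \<open>\<zeta>\<close> at time \<open>\<tau>\<close>, found by taking logarithms.\<close>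

definition hit :: "real \<Rightarrow> real \<Rightarrow> real" where
  "hit \<tau> \<zeta> = (ln (v0 / \<bar>\<zeta>\<bar>) + A * \<tau>) / (A + \<sigma>)"

lemma hit_iff:
  assumes "\<zeta> \<noteq> 0"
  shows "\<bar>\<zeta>\<bar> * exp (A * (t - \<tau>)) = v t \<longleftrightarrow> t = hit \<tau> \<zeta>"
proof -
  have a: "A + \<sigma> \<noteq> 0"
    using A_pos \<sigma>_pos by simp
  have "\<bar>\<zeta>\<bar> * exp (A * (t - \<tau>)) = v t \<longleftrightarrow> ln (\<bar>\<zeta>\<bar> * exp (A * (t - \<tau>))) = ln (v t)"
    using assms v_pos[of t] by (subst ln_inj_iff) auto
  also have "\<dots> \<longleftrightarrow> ln \<bar>\<zeta>\<bar> + A * (t - \<tau>) = ln v0 - \<sigma> * t"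
    using assms v0_pos by (simp add: trig_def ln_mult)
  also have "\<dots> \<longleftrightarrow> t * (A + \<sigma>) = ln (v0 / \<bar>\<zeta>\<bar>) + A * \<tau>"
    using assms v0_pos by (auto simp: ln_div algebra_simps)
  also have "\<dots> \<longleftrightarrow> t = hit \<tau> \<zeta>"
    using a by (simp add: hit_def nonzero_eq_divide_eq)
  finally show ?thesis .
qed

lemma hit_greater:
  assumes "\<zeta> \<noteq> 0" "\<bar>\<zeta>\<bar> < v \<tau>"
  shows "\<tau> < hit \<tau> \<zeta>"
proof (rule ccontr)
  let ?t = "hit \<tau> \<zeta>"
  assume "\<not> \<tau> < ?t"
  then have "\<bar>\<zeta>\<bar> * exp (A * (?t - \<tau>)) \<le> \<bar>\<zeta>\<bar> * 1"
    using A_pos by (intro mult_left_mono) (auto simp: mult_le_0_iff)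
  moreover have "\<bar>\<zeta>\<bar> * exp (A * (?t - \<tau>)) = v ?t"
    using hit_iff[OF assms(1)] by blast
  ultimately show False
    using assms(2) v_less[of ?t \<tau>] \<open>\<not> \<tau> < ?t\<close> by (cases "?t = \<tau>") auto
qed

text \<open>Recursion over the receptions: \<open>Z k\<close> is the error right after
  \<open>\<tau> k\<close>, it meets \<open>v\<close> at \<open>s k\<close>, and the packet arrives
  after the delay \<open>d k\<close>. A zero error would never trigger, hence
  \<open>z0 \<noteq> 0\<close>.\<close>

lemma ex_trajectory:
  assumes "z0 \<noteq> 0" "\<bar>z0\<bar> < v0" and d: "\<And>k. 0 \<le> d k" "\<And>k. d k \<le> \<gamma>"
  shows "\<exists>\<tau> Z s p. \<tau> 0 = 0 \<and> Z 0 = z0 \<and> (\<forall>k. Z k \<noteq> 0 \<and> \<tau> k < s k \<and> \<tau> (Suc k) = s k + d k \<and>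
    s k + min_gap \<le> s (Suc k) \<and> (\<forall>t. \<bar>Z k\<bar> * exp (A * (t - \<tau> k)) = v t \<longleftrightarrow> t = s k) \<and>
    p k = encode (rev (map s [0..<Suc k])) (Z k < 0) \<and>
    Z (Suc k) = Z k * exp (A * (\<tau> (Suc k) - \<tau> k)) - decode (\<tau> (Suc k)) (p k))"
proof -
  define step where "step k = (\<lambda>(ts, \<tau>, \<zeta>). let t = hit \<tau> \<zeta>; tc = t + d k in
    (t # ts, tc, \<zeta> * exp (A * (tc - \<tau>)) - decode tc (encode (t # ts) (\<zeta> < 0))))" for k
  define st where "st = rec_nat ([], 0, z0) step"
  define ts \<tau> Z where "ts k = fst (st k)" and "\<tau> k = fst (snd (st k))" and "Z k = snd (snd (st k))"
    for k
  define s where "s k = hit (\<tau> k) (Z k)" for k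
  define p where "p k = encode (s k # ts k) (Z k < 0)" for k
  have st: "st (Suc k) = (s k # ts k, s k + d k,
      Z k * exp (A * (s k + d k - \<tau> k)) - decode (s k + d k) (p k))" for k
    by (simp add: st_def step_def ts_def \<tau>_def Z_def s_def p_def Let_def split_beta)
  have init: "ts 0 = []" "\<tau> 0 = 0" "Z 0 = z0"
    by (simp_all add: ts_def \<tau>_def Z_def st_def)
  have ts_Suc: "ts (Suc k) = s k # ts k" and \<tau>_Suc: "\<tau> (Suc k) = s k + d k"
    and Z_Suc: "Z (Suc k) = Z k * exp (A * (\<tau> (Suc k) - \<tau> k)) - decode (\<tau> (Suc k)) (p k)" for k
    by (simp_all add: ts_def \<tau>_def Z_def st)
  have ts: "ts k = rev (map s [0..<k])" for k
    by (induction k) (simp_all add: init ts_Suc)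
  have recv: "s k \<le> \<tau> (Suc k)" "\<tau> (Suc k) \<le> s k + \<gamma>" for k
    using d[of k] by (simp_all add: \<tau>_Suc)
  have range: "\<kappa> * v (s k) \<le> Z (Suc k)" "Z (Suc k) \<le> \<rho> * exp (- \<sigma> * \<gamma>) * v (s k)"
    if "Z k \<noteq> 0" for k
  proof -
    have "\<bar>Z k * exp (A * (s k - \<tau> k))\<bar> = v (s k)"
      using hit_iff[OF that] by (simp add: s_def abs_mult)
    moreover have "Z k * exp (A * (s k - \<tau> k)) < 0 \<longleftrightarrow> Z k < 0"
      by (simp add: mult_less_0_iff)
    ultimately have "Z k * exp (A * (s k - \<tau> k)) = (if Z k < 0 then - v (s k) else v (s k))"
      by (simp add: abs_if split: if_splits)
    then have "(if Z k < 0 then - v (s k) else v (s k)) * exp (A * (\<tau> (Suc k) - s k)) =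
        Z k * (exp (A * (s k - \<tau> k)) * exp (A * (\<tau> (Suc k) - s k)))"
      by simp
    also have "\<dots> = Z k * exp (A * (\<tau> (Suc k) - \<tau> k))"
      by (simp add: algebra_simps flip: exp_add)
    finally show "\<kappa> * v (s k) \<le> Z (Suc k)" "Z (Suc k) \<le> \<rho> * exp (- \<sigma> * \<gamma>) * v (s k)"
      using residual_bounds[of "s k" "\<tau> (Suc k)", OF recv, of "Z k < 0" "ts k"] by (simp_all add: Z_Suc p_def)
  qed
  \<comment> \<open>This invariant puts each trigger strictly after the preceding reception, so the
    recursion describes successive events.\<close>
  have Z: "Z k \<noteq> 0 \<and> \<bar>Z k\<bar> < v (\<tau> k)" for k
  proof (induction k)
    case 0
    then show ?case
      using assms by (simp add: init trig_def)
  next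
    case (Suc k)
    have "0 < Z (Suc k)"
      using range(1)[of k] Suc \<kappa>_pos v_pos[of "s k"] by (smt (verit) mult_pos_pos)
    moreover have "Z (Suc k) < v (\<tau> (Suc k))"
      using residual_less_v[OF recv] range(2) Suc by blast
    ultimately show ?case
      by simp
  qed
  have hit: "\<bar>Z k\<bar> * exp (A * (t - \<tau> k)) = v t \<longleftrightarrow> t = s k" for k t
    using Z hit_iff by (simp add: s_def)
  have "s k + min_gap \<le> s (Suc k)" for k
  proof -
    have "\<bar>Z (Suc k)\<bar> = Z (Suc k)"
      using range(1)[of k] Z[of k] \<kappa>_pos v_pos[of "s k"] by (smt (verit) mult_pos_pos)
    then have "v (s (Suc k)) = Z (Suc k) * exp (A * (s (Suc k) - \<tau> (Suc k)))"
      using hit[of "Suc k" "s (Suc k)"] by simp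
    then show ?thesis
      using gap_bounds(1)[OF recv range] Z by fastforce
  qed
  moreover have "\<tau> k < s k" for k
    using Z[of k] hit_greater by (simp add: s_def)
  moreover have "p k = encode (rev (map s [0..<Suc k])) (Z k < 0)" for k
    by (simp add: p_def ts)
  ultimately show ?thesis
    using init Z \<tau>_Suc Z_Suc hit by (intro exI[of _ \<tau>] exI[of _ Z] exI[of _ s] exI[of _ p]) blast
qed

text \<open>For equal initial values the error stays zero and nothing is ever sent; otherwise the
  recursive trajectory gives a run with infinitely many transmissions.\<close>

lemma ex_run:
  assumes gain: "B * K = A + \<sigma> + 1"
    and "\<bar>x0 - xh0\<bar> < v0" and d: "\<And>k. 0 \<le> d k" "\<And>k. d k \<le> \<gamma>"
  shows "\<exists>r. closed_loop_run A B K \<gamma> v0 \<sigma> enc decode r \<and> plant_state r 0 = x0 \<and>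
    estimate r 0 = xh0 \<and> (\<forall>k\<in>trans_indices r. recv_time r k = send_time r k + d k)"
proof (cases "x0 = xh0")
  case True
  define y where "y t = x0 * exp (- (\<sigma> + 1) * t)" for t
  define r where "r = \<lparr>plant_state = y, estimate = y, num_trans = 0, send_time = (\<lambda>_. 0),
    recv_time = (\<lambda>_. 0), packet = (\<lambda>_. [])\<rparr>"
  have none: "trans_indices r = {}"
    by (simp add: trans_indices_def r_def enat_0_iff flip: zero_enat_def)
  have deriv: "(y has_real_derivative A * y t + B * (- K * y t)) (at t)" for t
  proof -
    have "(y has_real_derivative (- (\<sigma> + 1)) * y t) (at t)"
      unfolding y_def by (auto intro!: derivative_eq_intros)
    moreover have "A * y t + B * (- K * y t) = (- (\<sigma> + 1)) * y t"
      using gain by (simp add: algebra_simps flip: mult.assoc)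
    ultimately show ?thesis
      by simp
  qed
  have cont: "isCont y t" for t
    using deriv by (rule DERIV_isCont)
  then have limits: "(y \<longlongrightarrow> y t) (at_left t)" "(y \<longlongrightarrow> y t) (at_right t)" for t
    by (simp_all add: continuous_within filterlim_at_split)
  have "est_error r t = 0" for t
    by (simp add: est_error_def r_def)
  then have "closed_loop_run A B K \<gamma> v0 \<sigma> enc decode r"
    using deriv cont limits v_pos unfolding closed_loop_run_def Let_def none reception_times_def
    by (auto simp: r_def less_imp_neq continuous_at_imp_continuous_on)
  then show ?thesis
    using True none by (intro exI[of _ r]) (simp add: r_def y_def)
next
  case False
  obtain \<tau> Z s p where init: "\<tau> 0 = 0" "Z 0 = x0 - xh0"
    and Z: "\<And>k. Z k \<noteq> 0" and less: "\<And>k. \<tau> k < s k"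
    and recv: "\<And>k. \<tau> (Suc k) = s k + d k"
    and gaps: "\<And>k. s k + min_gap \<le> s (Suc k)"
    and hit: "\<And>k t. \<bar>Z k\<bar> * exp (A * (t - \<tau> k)) = v t \<longleftrightarrow> t = s k"
    and p: "\<And>k. p k = encode (rev (map s [0..<Suc k])) (Z k < 0)"
    and Z_Suc: "\<And>k. Z (Suc k) = Z k * exp (A * (\<tau> (Suc k) - \<tau> k)) - decode (\<tau> (Suc k)) (p k)"
    using ex_trajectory[of "x0 - xh0" d] False assms by auto metis
  have \<tau>_less: "\<tau> k < \<tau> (Suc k)" for k
    using less[of k] d(1)[of k] by (simp add: recv)
  have s_mono: "strict_mono s"
    unfolding strict_mono_Suc_iff using gaps min_gap_pos by (meson less_add_same_cancel1 less_le_trans)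
  have growth: "real k * min_gap \<le> s k" for k
  proof (induction k)
    case 0
    then show ?case
      using less[of 0] init by simp
  next
    case (Suc k)
    then show ?case
      using gaps[of k] by (simp add: distrib_right)
  qed
  have "\<exists>k. t \<le> \<tau> k" for t
  proof -
    obtain k where "t / min_gap \<le> real k"
      using real_arch_simple by blast
    then have "t \<le> s k"
      using growth[of k] min_gap_pos by (simp add: pos_divide_le_eq)
    also have "\<dots> \<le> \<tau> (Suc k)"
      using d by (simp add: recv)
    finally show ?thesis
      by blast
  qed
  then interpret time_partition \<tau>
    using \<tau>_less by unfold_locales (simp_all add: strict_mono_Suc_iff)
  have \<tau>_nonneg: "0 \<le> \<tau> k" for k
    using strict_mono init(1) strict_mono_less_eq[of \<tau> 0 k] by simp
  \<comment> \<open>\<open>Y k\<close> is the estimate right after \<open>\<tau> k\<close>. It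
    decays at the rate \<open>\<sigma> + 1\<close> because
    \<open>A - B * K = - (\<sigma> + 1)\<close>.\<close>
  define Y where "Y = rec_nat xh0 (\<lambda>k y. y * exp (- (\<sigma> + 1) * (\<tau> (Suc k) - \<tau> k)) +
    decode (\<tau> (Suc k)) (p k))"
  have Y_Suc: "Y (Suc k) = Y k * exp (- (\<sigma> + 1) * (\<tau> (Suc k) - \<tau> k)) + decode (\<tau> (Suc k)) (p k)" for k
    by (simp add: Y_def)
  define xh where "xh = piecewise_exp (- (\<sigma> + 1)) Y"
  define z where "z = piecewise_exp A Z"
  \<comment> \<open>This makes \<open>z\<close> the estimation error by construction. The jumps of
    \<open>xh\<close> and \<open>z\<close> are opposite, so the state is continuous.\<close>
  define x where "x t = xh t + z t" for t
  define r where "r = \<lparr>plant_state = x, estimate = xh, num_trans = \<infinity>, send_time = s,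
    recv_time = (\<lambda>k. \<tau> (Suc k)), packet = p\<rparr>"
  have all: "trans_indices r = UNIV"
    by (simp add: trans_indices_def r_def)
  have not_recv: "t \<noteq> \<tau> (Suc k)" if "t \<notin> reception_times r" for t k
    using that by (auto simp: reception_times_def all) (simp add: r_def)
  have s_cell: "s k \<in> cell k" for k
    using less[of k] d by (simp add: cell_def recv)
  have recv_cell: "\<tau> (Suc k) \<in> cell k" for k
    using \<tau>_less[of k] by (simp add: cell_def)
  have s_nonneg: "0 \<le> s k" for k
    using less[of k] \<tau>_nonneg[of k] by simp
  have zero_cell: "0 \<in> cell 0"
    using \<tau>_nonneg by (simp add: cell_def)
  have xh_deriv: "(xh has_real_derivative A * xh t + B * (- K * xh t)) (at t)"
    if "t \<notin> reception_times r" for t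
  proof -
    have "(xh has_real_derivative (- (\<sigma> + 1)) * xh t) (at t)"
      unfolding xh_def using that by (intro deriv_piecewise_exp not_recv)
    moreover have "A * xh t + B * (- K * xh t) = (- (\<sigma> + 1)) * xh t"
      using gain by (simp add: algebra_simps flip: mult.assoc)
    ultimately show ?thesis
      by simp
  qed
  have x_deriv: "(x has_real_derivative A * x t + B * (- K * xh t)) (at t)"
    if "t \<notin> reception_times r" for t
  proof -
    have "(z has_real_derivative A * z t) (at t)"
      unfolding z_def using that by (intro deriv_piecewise_exp not_recv)
    from DERIV_add[OF xh_deriv[OF that] this] show ?thesis
      by (simp add: x_def[abs_def] algebra_simps)
  qed
  have xh_left: "(xh \<longlongrightarrow> xh t) (at_left t)" for t
    unfolding xh_def by (rule piecewise_exp_left)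
  have xh_right: "(xh \<longlongrightarrow> xh t) (at_right t)" if "t \<notin> reception_times r" for t
    unfolding xh_def using that by (intro piecewise_exp_right not_recv)
  have xh_recv: "xh (\<tau> (Suc k)) = Y k * exp (- (\<sigma> + 1) * (\<tau> (Suc k) - \<tau> k))" for k
    by (simp add: xh_def piecewise_exp_cell[OF recv_cell])
  have xh_jump: "(xh \<longlongrightarrow> decode (\<tau> (Suc k)) (p k) + xh (\<tau> (Suc k))) (at_right (\<tau> (Suc k)))" for k
    using piecewise_exp_jump[of "- (\<sigma> + 1)" Y k, folded xh_def]
    by (simp only: xh_recv Y_Suc add.commute)
  have x_left: "(x \<longlongrightarrow> x t) (at_left t)" for t
    unfolding x_def z_def by (intro tendsto_add xh_left piecewise_exp_left)
  have x_right: "(x \<longlongrightarrow> x t) (at_right t)" for t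
  proof (cases "t \<in> reception_times r")
    case True
    then obtain k where t: "t = \<tau> (Suc k)"
      by (auto simp: reception_times_def all) (simp add: r_def)
    have "z (\<tau> (Suc k)) = Z k * exp (A * (\<tau> (Suc k) - \<tau> k))"
      by (simp add: z_def piecewise_exp_cell[OF recv_cell])
    then have "x t = (decode t (p k) + xh t) + Z (Suc k)"
      by (simp add: x_def t Z_Suc)
    moreover have "((\<lambda>t. xh t + z t) \<longlongrightarrow> (decode t (p k) + xh t) + Z (Suc k)) (at_right t)"
      unfolding t z_def by (intro tendsto_add xh_jump piecewise_exp_jump)
    ultimately show ?thesis
      by (simp only: x_def[abs_def])
  qed (use DERIV_isCont[OF x_deriv] in \<open>simp add: continuous_within filterlim_at_split\<close>)
  have x_cont: "continuous_on {0..} x"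
    using x_left x_right by (intro continuous_at_imp_continuous_on)
      (simp add: continuous_within filterlim_at_split)
  have error: "est_error r t = z t" for t
    by (simp add: est_error_def r_def x_def)
  have crossing: "\<bar>z t\<bar> = v t \<longleftrightarrow> t = s k" if "t \<in> cell k" for t k
    using hit[of k t] by (simp add: z_def piecewise_exp_cell[OF that] abs_mult)
  have triggers: "range s = {t. 0 \<le> t \<and> \<bar>z t\<bar> = v t}"
  proof (intro set_eqI iffI)
    fix t
    show "t \<in> {t. 0 \<le> t \<and> \<bar>z t\<bar> = v t}" if "t \<in> range s"
      using that crossing[OF s_cell] s_nonneg by auto
    show "t \<in> range s" if "t \<in> {t. 0 \<le> t \<and> \<bar>z t\<bar> = v t}"
      using that crossing cell_exists[of t] by blast
  qed
  have packets: "p k = enc (map s [0..<Suc k]) (restrict x {0..s k}) (restrict xh {0..s k})" for k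
  proof -
    have "x (s k) < xh (s k) \<longleftrightarrow> Z k < 0"
      by (simp add: x_def z_def piecewise_exp_cell[OF s_cell] mult_less_0_iff)
    then show ?thesis
      using s_nonneg[of k] by (simp add: enc_def p)
  qed
  have "closed_loop_run A B K \<gamma> v0 \<sigma> enc decode r"
    unfolding closed_loop_run_def Let_def all error
    using x_cont x_deriv xh_deriv xh_left xh_right xh_jump s_mono triggers d packets
    by (simp add: recv r_def del: upt_Suc)
  moreover have "xh 0 = xh0" "z 0 = x0 - xh0"
    using init by (simp_all add: xh_def z_def piecewise_exp_cell[OF zero_cell] Y_def)
  ultimately show ?thesis
    by (intro exI[of _ r]) (simp add: r_def x_def recv)
qed

end

subsection \<open>Sufficiency of the rate condition\<close>

lemma (in event_coding) stability:
  assumes gain: "B * K = A + \<sigma> + 1" and "0 < e"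
  obtains \<delta> where "0 < \<delta>" "\<And>r t. closed_loop_run A B K \<gamma> v0 \<sigma> enc decode r \<Longrightarrow>
    \<bar>est_error r 0\<bar> < v0 \<Longrightarrow> \<bar>plant_state r 0\<bar> < \<delta> \<Longrightarrow> \<bar>estimate r 0\<bar> < \<delta> \<Longrightarrow> 0 \<le> t \<Longrightarrow>
    \<bar>plant_state r t\<bar> < e"
proof -
  define C where "C = (A + \<sigma> + 1) * (overshoot * v0)"
  have "((\<lambda>T. C * exp (- \<sigma> * T)) \<longlongrightarrow> 0) at_top"
    using \<sigma>_pos by (intro tendsto_mult_right_zero tendsto_exp_neg_at_top)
  then have "\<forall>\<^sub>F T in at_top. C * exp (- \<sigma> * T) < e / 2"
    using \<open>0 < e\<close> by (elim order_tendstoD(2)) simp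
  then have "\<forall>\<^sub>F T in at_top. C * exp (- \<sigma> * T) < e / 2 \<and> 0 \<le> T"
    using eventually_ge_at_top[of 0] by eventually_elim auto
  then obtain T where T: "C * exp (- \<sigma> * T) < e / 2" "0 \<le> T"
    using eventually_happens by fastforce
  \<comment> \<open>The initial error is below \<open>2 * \<delta>\<close>, so the second term keeps
    it below \<open>v\<close> up to time \<open>T\<close>; the first leaves \<open>e / 2\<close> for
    the contribution of the error.\<close>
  define \<delta> where "\<delta> = min (e / 2) (v T * exp (- A * T) / 2)"
  have "\<bar>plant_state r t\<bar> < e"
    if run: "closed_loop_run A B K \<gamma> v0 \<sigma> enc decode r" "\<bar>est_error r 0\<bar> < v0"
      and small: "\<bar>plant_state r 0\<bar> < \<delta>" "\<bar>estimate r 0\<bar> < \<delta>" and "0 \<le> t" for r t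
  proof -
    interpret coded_run A \<sigma> \<gamma> v0 \<rho> R w \<epsilon> m short_code long_code B K r
      using gain run by unfold_locales
    have "\<bar>est_error r 0\<bar> < v T * exp (- A * T)"
      using small unfolding est_error_def \<delta>_def by linarith
    then have "\<bar>est_error r 0\<bar> * exp (A * T) < v T"
      by (simp add: exp_minus divide_inverse[symmetric] pos_less_divide_eq)
    then have "\<bar>plant_state r t\<bar> \<le> \<bar>plant_state r 0\<bar> + (A + \<sigma> + 1) * (overshoot * v T)"
      using T(2) \<open>0 \<le> t\<close> by (intro state_small)
    also have "(A + \<sigma> + 1) * (overshoot * v T) = C * exp (- \<sigma> * T)"
      by (simp add: C_def trig_def)
    finally show ?thesis
      using T(1) small(1) by (simp add: \<delta>_def)
  qed
  moreover have "0 < \<delta>"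
    using \<open>0 < e\<close> v_pos[of T] by (simp add: \<delta>_def)
  ultimately show ?thesis
    using that by blast
qed

lemma ex_event_coding:
  fixes A \<gamma> v0 \<sigma> \<rho> b R :: real
  assumes "0 < A" "0 \<le> \<gamma>" "0 < v0" "0 < \<sigma>" "0 < \<rho>" "\<rho> < 1" "1 < b"
    and "sufficient_rate A \<gamma> \<sigma> \<rho> b \<le> R"
  obtains w \<epsilon> m short_code long_code
  where "event_coding A \<sigma> \<gamma> v0 \<rho> R w \<epsilon> m short_code long_code"
proof -
  define \<eta> where "\<eta> = \<rho> * exp (- (\<sigma> + A) * \<gamma>)"
  define w where "w = ln (1 + \<eta>) / (A + \<sigma>) / b"
  define G where "G = (if \<gamma> = 0 then 0 else max 0 (1 + log 2 (b * \<gamma> * (A + \<sigma>) / ln (1 + \<eta>))))"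
  define m where "m = nat \<lfloor>G\<rfloor>"
  have "0 < \<eta>"
    using assms by (simp add: \<eta>_def)
  then have ln_pos: "0 < ln (1 + \<eta>)"
    by simp
  then have "0 < w"
    using assms by (simp add: w_def)
  have "0 \<le> G"
    by (simp add: G_def)
  then have m: "real m \<le> G" "G < real m + 1"
    unfolding m_def by linarith+
  \<comment> \<open>The logarithm in the rate condition is \<open>log 2 (\<gamma> / w)\<close>. Its
    companion summand 1 and \<open>G < real m + 1\<close> bring it below \<open>m\<close>.\<close>
  have "\<gamma> < 2 ^ m * w"
  proof (cases "\<gamma> = 0")
    case False
    then have "0 < \<gamma> / w" and X: "b * \<gamma> * (A + \<sigma>) / ln (1 + \<eta>) = \<gamma> / w"
      using assms \<open>0 < w\<close> ln_pos by (simp_all add: w_def)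
    have "log 2 (\<gamma> / w) < real m"
      using m(2) False unfolding G_def X by simp
    then have "\<gamma> / w < 2 powr real m"
      using \<open>0 < \<gamma> / w\<close> by (simp add: log_less_iff)
    then show ?thesis
      using \<open>0 < w\<close> by (simp add: powr_realpow pos_divide_less_eq)
  qed (use \<open>0 < w\<close> in simp)
  then obtain lab :: "real \<Rightarrow> nat" where lab: "\<And>t. lab t < 2 ^ Suc m - 1"
    "\<And>t t'. lab t = lab t' \<Longrightarrow> \<bar>t - t'\<bar> \<le> \<gamma> \<Longrightarrow> \<bar>t - t'\<bar> \<le> w"
    using cyclic_labelling[of \<gamma> w m] assms \<open>0 < w\<close> by blast
  obtain c :: "nat \<Rightarrow> bool list" where c: "inj_on c {..<2 ^ Suc m - 1}" "\<And>i. i < 2 ^ Suc m - 1 \<Longrightarrow> length (c i) \<le> m"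
    using ex_bit_codes(1)[of m] by blast
  obtain c' :: "nat \<Rightarrow> bool list" where c': "inj_on c' {..<2 ^ Suc m}" "\<And>i. i < 2 ^ Suc m \<Longrightarrow> length (c' i) = Suc m"
    using ex_bit_codes(2)[of "Suc m"] by blast
  have lab': "lab t < 2 ^ Suc m" for t
    using lab(1)[of t] by linarith
  have ln_neg: "ln (\<rho> * exp (- \<sigma> * \<gamma>)) < 0"
  proof -
    have "ln \<rho> < 0" "0 \<le> \<sigma> * \<gamma>"
      using assms by simp_all
    moreover have "ln (\<rho> * exp (- \<sigma> * \<gamma>)) = ln \<rho> - \<sigma> * \<gamma>"
      using assms by (simp add: ln_mult)
    ultimately show ?thesis
      by linarith
  qed
  have R: "(A + \<sigma>) / (- ln (\<rho> * exp (- \<sigma> * \<gamma>))) * G \<le> R"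
    using assms(8) unfolding sufficient_rate_def G_def \<eta>_def .
  \<comment> \<open>The margin \<open>b * w - w\<close> is positive as \<open>b > 1\<close>, and
    together with \<open>w\<close> it exhausts \<open>precision\<close> with equality.\<close>
  have "event_coding A \<sigma> \<gamma> v0 \<rho> R w (b * w - w) m (c \<circ> lab) (c' \<circ> lab)"
  proof
    show "0 \<le> R"
    proof (rule order_trans[OF _ R])
      show "0 \<le> (A + \<sigma>) / (- ln (\<rho> * exp (- \<sigma> * \<gamma>))) * G"
        using assms ln_neg \<open>0 \<le> G\<close> by (intro mult_nonneg_nonneg divide_nonneg_pos) linarith+
    qed
    show "real m * (A + \<sigma>) \<le> R * - ln (\<rho> * exp (- \<sigma> * \<gamma>))"
    proof -
      have "real m * (A + \<sigma>) \<le> G * (A + \<sigma>)"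
        using m assms by (intro mult_right_mono) auto
      also have "\<dots> \<le> R * - ln (\<rho> * exp (- \<sigma> * \<gamma>))"
        using R ln_neg by (simp add: field_simps)
      finally show ?thesis .
    qed
    have "(A + \<sigma>) * (w + (b * w - w)) = ln (1 + \<eta>)"
      using assms by (simp add: w_def)
    then have "exp ((A + \<sigma>) * (w + (b * w - w))) = 1 + \<eta>"
      using \<open>0 < \<eta>\<close> by simp
    then show "exp ((A + \<sigma>) * (w + (b * w - w))) \<le> 1 + \<rho> * exp (- (\<sigma> + A) * \<gamma>)"
      unfolding \<eta>_def by (rule eq_refl)
    show "0 < b * w - w"
      using assms \<open>0 < w\<close> by simp
    show "length ((c \<circ> lab) t) \<le> m" "length ((c' \<circ> lab) t) = Suc m" for t
      using c(2) c'(2) lab(1) lab' by simp_all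
    show "\<bar>t - t'\<bar> \<le> w" if "(c \<circ> lab) t = (c \<circ> lab) t'" "\<bar>t - t'\<bar> \<le> \<gamma>" for t t'
      using that lab(1) lab(2)[of t t'] inj_onD[OF c(1)] by simp
    show "\<bar>t - t'\<bar> \<le> w" if "(c' \<circ> lab) t = (c' \<circ> lab) t'" "\<bar>t - t'\<bar> \<le> \<gamma>" for t t'
      using that lab' lab(2)[of t t'] inj_onD[OF c'(1)] by simp
  qed (use assms \<open>0 < w\<close> in auto)
  then show ?thesis
    by (rule that)
qed

text \<open>A run for every delay sequence keeps the claims about all runs from being vacuous. The
  rate is claimed only for infinitely many transmissions, where the limsup is meaningful.\<close>

theorem corollary1:
  fixes A B L \<gamma> v0 \<sigma> \<rho>0 b R :: real
  assumes "A > 0" and "B \<noteq> 0" and "L > 0" and "\<gamma> \<ge> 0"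
    and "v0 > 0" and "\<sigma> > 0" and "0 < \<rho>0" and "\<rho>0 < 1" and "b > 1"
    and "R \<ge> sufficient_rate A \<gamma> \<sigma> \<rho>0 b"
  shows "\<exists>(enc :: encoder) (dec :: decoder) (K :: real).
    (\<forall>x0 xh0 (d :: nat \<Rightarrow> real).
       \<bar>x0\<bar> < L \<and> \<bar>x0 - xh0\<bar> < v0 \<and> (\<forall>k. 0 \<le> d k \<and> d k \<le> \<gamma>) \<longrightarrow>
       (\<exists>r. admissible_run A B K L \<gamma> v0 \<sigma> enc dec r \<and>
            plant_state r 0 = x0 \<and> estimate r 0 = xh0 \<and>
            (\<forall>k\<in>trans_indices r. recv_time r k = send_time r k + d k))) \<and>
    (\<forall>r. admissible_run A B K L \<gamma> v0 \<sigma> enc dec r \<longrightarrow>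
       (\<forall>k\<in>trans_indices r.
          \<bar>right_limit (est_error r) (recv_time r k)\<bar>
            \<le> \<rho>0 * exp (- \<sigma> * \<gamma>) * trig v0 \<sigma> (send_time r k)) \<and>
       (num_trans r = \<infinity> \<longrightarrow> info_rate r = ereal R) \<and>
       (plant_state r \<longlongrightarrow> 0) at_top) \<and>
    (\<forall>\<epsilon>>0. \<exists>\<delta>>0. \<forall>r. admissible_run A B K L \<gamma> v0 \<sigma> enc dec r \<and>
       \<bar>plant_state r 0\<bar> < \<delta> \<and> \<bar>estimate r 0\<bar> < \<delta> \<longrightarrow>
       (\<forall>t\<ge>0. \<bar>plant_state r t\<bar> < \<epsilon>))"
proof -
  obtain w \<epsilon> m short_code long_code
    where "event_coding A \<sigma> \<gamma> v0 \<rho>0 R w \<epsilon> m short_code long_code"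
    using ex_event_coding assms by blast
  then interpret event_coding A \<sigma> \<gamma> v0 \<rho>0 R w \<epsilon> m short_code long_code .
  \<comment> \<open>Puts the closed-loop pole at \<open>- (\<sigma> + 1)\<close>, so the loop decays
    faster than \<open>v\<close>.\<close>
  define K where "K = (A + \<sigma> + 1) / B"
  have gain: "B * K = A + \<sigma> + 1"
    using assms by (simp add: K_def)
  show ?thesis
  proof (intro exI[of _ enc] exI[of _ decode] exI[of _ K] conjI; intro allI impI)
    fix x0 xh0 :: real and d :: "nat \<Rightarrow> real"
    assume *: "\<bar>x0\<bar> < L \<and> \<bar>x0 - xh0\<bar> < v0 \<and> (\<forall>k. 0 \<le> d k \<and> d k \<le> \<gamma>)"
    obtain r where "closed_loop_run A B K \<gamma> v0 \<sigma> enc decode r" "plant_state r 0 = x0"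
      "estimate r 0 = xh0" "\<forall>k\<in>trans_indices r. recv_time r k = send_time r k + d k"
      using ex_run[OF gain, of x0 xh0 d] * by blast
    then show "\<exists>r. admissible_run A B K L \<gamma> v0 \<sigma> enc decode r \<and>
        plant_state r 0 = x0 \<and> estimate r 0 = xh0 \<and>
        (\<forall>k\<in>trans_indices r. recv_time r k = send_time r k + d k)"
      using * by (intro exI[of _ r]) (simp add: admissible_run_def est_error_def)
  next
    fix r
    assume "admissible_run A B K L \<gamma> v0 \<sigma> enc decode r"
    then interpret coded_run A \<sigma> \<gamma> v0 \<rho>0 R w \<epsilon> m short_code long_code B K r
      using gain by unfold_locales (auto simp: admissible_run_def)
    show "(\<forall>k\<in>trans_indices r.
          \<bar>right_limit (est_error r) (recv_time r k)\<bar>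
            \<le> \<rho>0 * exp (- \<sigma> * \<gamma>) * trig v0 \<sigma> (send_time r k)) \<and>
       (num_trans r = \<infinity> \<longrightarrow> info_rate r = ereal R) \<and>
       (plant_state r \<longlongrightarrow> 0) at_top"
      using right_limit_recv info_rate_eq state_tendsto_0 by blast
  next
    fix e :: real
    assume "0 < e"
    then obtain \<delta> where \<delta>: "0 < \<delta>" "\<And>r t. closed_loop_run A B K \<gamma> v0 \<sigma> enc decode r \<Longrightarrow>
        \<bar>est_error r 0\<bar> < v0 \<Longrightarrow> \<bar>plant_state r 0\<bar> < \<delta> \<Longrightarrow> \<bar>estimate r 0\<bar> < \<delta> \<Longrightarrow> 0 \<le> t \<Longrightarrow>
        \<bar>plant_state r t\<bar> < e"
      using stability[OF gain] by blast
    then show "\<exists>\<delta>>0. \<forall>r. admissible_run A B K L \<gamma> v0 \<sigma> enc decode r \<and>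
        \<bar>plant_state r 0\<bar> < \<delta> \<and> \<bar>estimate r 0\<bar> < \<delta> \<longrightarrow> (\<forall>t\<ge>0. \<bar>plant_state r t\<bar> < e)"
      by (intro exI[of _ \<delta>]) (auto simp: admissible_run_def)
  qed
qed

end
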